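(* Let $G$ and $H$ be finitely generated groups with finite generating sets $S_G,S_H$, let $(\mathcal{G}_n)_n$ be a sofic approximation of $(G,S_G)$, let $\mathcal{U}$ be a non-principal ultrafilter on $\mathbb{N}$, and let $\mathfrak{u}_n\colon \mathcal{G}_n\to H$ be a sequence of injective maps which is $\mathcal{U}$-statistically Lipschitz. Then there exists an injective measure subgroup coupling $(\Omega,\mu)$ from $G$ to $H$.
   Context: Word metrics and Cayley graphs: $|g|$ is the word length; the Cayley graph has edges $(x,xs)$ labeled by $s$, so $d(x,y)=|x^{-1}y|$. The group $H$ carries the metric $d_H$ so obtained from $S_H$. Sofic approximation of $(G,S_G)$: a sequence $(\mathcal{G}_n)_n$ of finite directed graphs with edges labeled by $S_G$, of uniformly bounded degree, such that for every $r>0$ the set $\mathcal{G}_n^{(r)}$ of vertices $x$ for which the ball $B_{\mathcal{G}_n}(x,r)$ is isomorphic (as a directed labeled graph, $x$ corresponding to $e_G$) to $B_G(e_G,r)$ satisfies $\lim_n \#\mathcal{G}_n^{(r)}/\#\mathcal{G}_n=1$. A graph is identified with its vertex set, with the graph metric. $\mathbb{P}_X$ is the uniform probability measure on a finite set $X$. $\mathcal{U}$-statistically Lipschitz: for every $r>0$, $\lim_{C\to\infty}\lim_{\mathcal{U}}\mathbb{P}_{\mathcal{G}_n}(\{y\in\mathcal{G}_n\mid \operatorname{diam}_{H}(\mathfrak{u}_n(B_{\mathcal{G}_n}(y,r)))\ge C\})=0$. Measure subgroup coupling from $G$ to $H$: a standard Borel $\sigma$-finite measure space $(\Omega,\mu)$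 with commuting, free, measure preserving actions of $G$ and $H$ (denoted $*$) admitting Borel fundamental domains $X_G$ and $X_H$ respectively (up to null sets: $\mu(g*X_G\cap X_G)=0$ for $g\ne e_G$ and $\mu(\Omega\setminus G*X_G)=0$, similarly for $H$), with $\mu(X_H)=1$ (and $\mu(X_G)$ possibly infinite). Its cocycle $\alpha\colon G\times X_H\to H$ is defined by: $\alpha(g,x)$ is the unique element of $H$ with $\alpha(g,x)*(g*x)\in X_H$ (for a.e. $x$). The coupling is injective if for a.e. $x\in X_H$ the map $\alpha(\cdot,x)\colon G\to H$ is injective. *)

theory Defs
  imports "HOL-Analysis.Analysis" "HOL-Algebra.Generated_Groups" "HOL-Algebra.Group_Action"
begin

section \<open>Word metrics\<close>

definition word_length :: "('g, 'm) monoid_scheme \<Rightarrow> 'g set \<Rightarrow> 'g \<Rightarrow> nat" where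
  "word_length G S g =
     (LEAST k. \<exists>w. length w = k \<and> set w \<subseteq> S \<union> m_inv G ` S \<and> foldr (mult G) w (one G) = g)"

definition word_dist :: "('g, 'm) monoid_scheme \<Rightarrow> 'g set \<Rightarrow> 'g \<Rightarrow> 'g \<Rightarrow> nat" where
  "word_dist G S x y = word_length G S (inv\<^bsub>G\<^esub> x \<otimes>\<^bsub>G\<^esub> y)"

text \<open>Only meaningful for nonempty sets of finite diameter; it is applied to finite nonempty sets.\<close>
definition word_diam :: "('g, 'm) monoid_scheme \<Rightarrow> 'g set \<Rightarrow> 'g set \<Rightarrow> real" where
  "word_diam G S A = (SUP (x, y) \<in> A \<times> A. real (word_dist G S x y))"

section \<open>Labeled directed graphs and sofic approximations\<close>

text \<open>An edge \<open>(x, s, y)\<close> goes from \<open>x\<close> to \<open>y\<close> and is labeled by \<open>s\<close>; loops and parallel edges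
  with different labels are possible.\<close>
record ('v, 'l) lgraph =
  verts :: "'v set"
  edges :: "('v \<times> 'l \<times> 'v) set"

definition finite_lgraph_over :: "'l set \<Rightarrow> ('v, 'l) lgraph \<Rightarrow> bool" where
  "finite_lgraph_over S X \<longleftrightarrow> finite (verts X) \<and> edges X \<subseteq> verts X \<times> S \<times> verts X"

definition lgraph_degree :: "('v, 'l) lgraph \<Rightarrow> 'v \<Rightarrow> nat" where
  "lgraph_degree X x = card {(y, s, z) \<in> edges X. y = x \<or> z = x}"

text \<open>The graph metric ignores the orientation of edges, as the word metric does; it is
  \<open>\<infinity>\<close> between different connected components.\<close>
definition adj :: "('v, 'l) lgraph \<Rightarrow> ('v \<times> 'v) set" where
  "adj X = {(x, y). \<exists>s. (x, s, y) \<in> edges X \<or> (y, s, x) \<in> edges X}"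

definition graph_dist :: "('v, 'l) lgraph \<Rightarrow> 'v \<Rightarrow> 'v \<Rightarrow> enat" where
  "graph_dist X x y = (INF k \<in> {k. (x, y) \<in> adj X ^^ k}. enat k)"

definition graph_ball :: "('v, 'l) lgraph \<Rightarrow> 'v \<Rightarrow> real \<Rightarrow> 'v set" where
  "graph_ball X x r = {y \<in> verts X. ereal_of_enat (graph_dist X x y) \<le> ereal r}"

definition cayley_graph :: "('g, 'm) monoid_scheme \<Rightarrow> 'g set \<Rightarrow> ('g, 'g) lgraph" where
  "cayley_graph G S =
     \<lparr>verts = carrier G, edges = {(x, s, x \<otimes>\<^bsub>G\<^esub> s) | x s. x \<in> carrier G \<and> s \<in> S}\<rparr>"

text \<open>Balls carry the induced labeled subgraph structure.\<close>
definition ball_iso ::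
    "('v, 'l) lgraph \<Rightarrow> 'v \<Rightarrow> ('w, 'l) lgraph \<Rightarrow> 'w \<Rightarrow> real \<Rightarrow> bool" where
  "ball_iso X x Y y r \<longleftrightarrow>
     (\<exists>f. bij_betw f (graph_ball X x r) (graph_ball Y y r) \<and> f x = y \<and>
          (\<forall>u \<in> graph_ball X x r. \<forall>v \<in> graph_ball X x r. \<forall>s.
             (u, s, v) \<in> edges X \<longleftrightarrow> (f u, s, f v) \<in> edges Y))"

definition good_verts ::
    "('g, 'm) monoid_scheme \<Rightarrow> 'g set \<Rightarrow> ('v, 'g) lgraph \<Rightarrow> real \<Rightarrow> 'v set" where
  "good_verts G S X r = {x \<in> verts X. ball_iso X x (cayley_graph G S) \<one>\<^bsub>G\<^esub> r}"

definition sofic_approximation ::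
    "('g, 'm) monoid_scheme \<Rightarrow> 'g set \<Rightarrow> (nat \<Rightarrow> ('v, 'g) lgraph) \<Rightarrow> bool" where
  "sofic_approximation G S \<G> \<longleftrightarrow>
     (\<forall>n. finite_lgraph_over S (\<G> n)) \<and>
     (\<exists>D. \<forall>n. \<forall>x \<in> verts (\<G> n). lgraph_degree (\<G> n) x \<le> D) \<and>
     (\<forall>r > 0. (\<lambda>n. real (card (good_verts G S (\<G> n) r)) / real (card (verts (\<G> n)))) \<longlonglongrightarrow> 1)"

section \<open>Ultrafilters and statistically Lipschitz maps\<close>

definition nonprincipal_ultrafilter :: "'i filter \<Rightarrow> bool" where
  "nonprincipal_ultrafilter U \<longleftrightarrow>
     U \<noteq> bot \<and>
     (\<forall>P. eventually P U \<or> eventually (\<lambda>i. \<not> P i) U) \<and>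
     (\<forall>j. \<not> eventually (\<lambda>i. i = j) U)"

text \<open>The inner limit exists, being that of a sequence in \<open>[0, 1]\<close> along an ultrafilter.\<close>
definition statistically_lipschitz ::
    "nat filter \<Rightarrow> (nat \<Rightarrow> ('v, 'l) lgraph) \<Rightarrow> ('h, 'm) monoid_scheme \<Rightarrow> 'h set \<Rightarrow>
     (nat \<Rightarrow> 'v \<Rightarrow> 'h) \<Rightarrow> bool" where
  "statistically_lipschitz U \<G> H S u \<longleftrightarrow>
     (\<forall>r > 0.
       ((\<lambda>C. Lim U (\<lambda>n.
           measure (uniform_count_measure (verts (\<G> n)))
             {y \<in> verts (\<G> n). word_diam H S (u n ` graph_ball (\<G> n) y r) \<ge> C}))
        \<longlongrightarrow> 0) (at_top :: real filter))"

section \<open>Measure subgroup couplings\<close>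

definition standard_borel :: "'w measure \<Rightarrow> bool" where
  "standard_borel M \<longleftrightarrow>
     (\<exists>T. completely_metrizable_space T \<and> second_countable T \<and>
          topspace T = space M \<and> sets M = sigma_sets (space M) {A. openin T A})"

definition free_action :: "('g, 'm) monoid_scheme \<Rightarrow> 'w set \<Rightarrow> ('g \<Rightarrow> 'w \<Rightarrow> 'w) \<Rightarrow> bool" where
  "free_action G E \<phi> \<longleftrightarrow> (\<forall>x \<in> E. stabilizer G \<phi> x = {\<one>\<^bsub>G\<^esub>})"

definition measure_preserving_action ::
    "('g, 'm) monoid_scheme \<Rightarrow> 'w measure \<Rightarrow> ('g \<Rightarrow> 'w \<Rightarrow> 'w) \<Rightarrow> bool" where
  "measure_preserving_action G M \<phi> \<longleftrightarrow>
     group_action G (space M) \<phi> \<and>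
     (\<forall>g \<in> carrier G. \<phi> g \<in> M \<rightarrow>\<^sub>M M \<and> distr M M (\<phi> g) = M)"

definition fundamental_domain ::
    "('g, 'm) monoid_scheme \<Rightarrow> 'w measure \<Rightarrow> ('g \<Rightarrow> 'w \<Rightarrow> 'w) \<Rightarrow> 'w set \<Rightarrow> bool" where
  "fundamental_domain G M \<phi> X \<longleftrightarrow>
     X \<in> sets M \<and>
     (\<forall>g \<in> carrier G. g \<noteq> \<one>\<^bsub>G\<^esub> \<longrightarrow> emeasure M (\<phi> g ` X \<inter> X) = 0) \<and>
     emeasure M (space M - (\<Union>g \<in> carrier G. \<phi> g ` X)) = 0"

definition measure_subgroup_coupling ::
    "('g, 'm) monoid_scheme \<Rightarrow> ('h, 'k) monoid_scheme \<Rightarrow> 'w measure \<Rightarrow>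
     ('g \<Rightarrow> 'w \<Rightarrow> 'w) \<Rightarrow> ('h \<Rightarrow> 'w \<Rightarrow> 'w) \<Rightarrow> 'w set \<Rightarrow> 'w set \<Rightarrow> bool" where
  "measure_subgroup_coupling G H M \<phi> \<psi> X\<^sub>G X\<^sub>H \<longleftrightarrow>
     standard_borel M \<and> sigma_finite_measure M \<and>
     measure_preserving_action G M \<phi> \<and> measure_preserving_action H M \<psi> \<and>
     free_action G (space M) \<phi> \<and> free_action H (space M) \<psi> \<and>
     (\<forall>g \<in> carrier G. \<forall>h \<in> carrier H. \<forall>x \<in> space M. \<phi> g (\<psi> h x) = \<psi> h (\<phi> g x)) \<and>
     fundamental_domain G M \<phi> X\<^sub>G \<and> fundamental_domain H M \<psi> X\<^sub>H \<and>
     emeasure M X\<^sub>H = 1"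

text \<open>Outside a null set of \<open>x\<close> there is exactly one such \<open>h\<close> for each \<open>g\<close>; elsewhere the value
  is arbitrary.\<close>
definition coupling_cocycle ::
    "('h, 'k) monoid_scheme \<Rightarrow> ('g \<Rightarrow> 'w \<Rightarrow> 'w) \<Rightarrow> ('h \<Rightarrow> 'w \<Rightarrow> 'w) \<Rightarrow> 'w set \<Rightarrow> 'g \<Rightarrow> 'w \<Rightarrow> 'h" where
  "coupling_cocycle H \<phi> \<psi> X\<^sub>H g x = (THE h. h \<in> carrier H \<and> \<psi> h (\<phi> g x) \<in> X\<^sub>H)"

definition injective_coupling ::
    "('g, 'm) monoid_scheme \<Rightarrow> ('h, 'k) monoid_scheme \<Rightarrow> 'w measure \<Rightarrow>
     ('g \<Rightarrow> 'w \<Rightarrow> 'w) \<Rightarrow> ('h \<Rightarrow> 'w \<Rightarrow> 'w) \<Rightarrow> 'w set \<Rightarrow> bool" where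
  "injective_coupling G H M \<phi> \<psi> X\<^sub>H \<longleftrightarrow>
     (AE x in M. x \<in> X\<^sub>H \<longrightarrow> inj_on (\<lambda>g. coupling_cocycle H \<phi> \<psi> X\<^sub>H g x) (carrier G))"

text \<open>Existence statements cannot quantify over the underlying type of a measure space. Since every
  standard Borel space has at most the cardinality of the continuum, and the notions above only
  depend on the measure space up to bijective renaming of its points, requiring a coupling
  of type \<^typ>\<open>real measure\<close> is no restriction. (The topology of the space in
  \<^const>\<open>standard_borel\<close> is unrelated to that of the reals.)\<close>

end

theory Submission
  imports Defs "HOL-Probability.Projective_Limit" "HOL-Probability.Probability_Mass_Function"
begin

text \<open>
  The space underlying the coupling is the set \<open>\<Omega>\<close> of all injective maps \<open>f\<close> from \<open>G\<close> to \<open>H\<close>. The group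
  \<open>G\<close> acts on it by \<open>(g * f) k = f (inv g k)\<close> and \<open>H\<close> acts by \<open>(h * f) k = h (f k)\<close>. These actions
  commute. Both have explicit fundamental domains: for \<open>H\<close> the maps with \<open>f 1 = 1\<close>, and for \<open>G\<close> the maps
  whose value at \<open>1\<close> comes first in their range, in some enumeration of \<open>H\<close>. Freeness of the action of
  \<open>G\<close>, the fundamental domain of \<open>G\<close> and injectivity of the cocycle, which is \<open>g \<mapsto> inv (f (inv g))\<close>, all
  result from injectivity of the maps. What is left is to find an invariant measure.

  A random vertex \<open>v\<close> of \<open>\<G> n\<close> gives the random map \<open>g \<mapsto> inv (u n v) (u n (v g))\<close>, where \<open>v g\<close> is the end
  of the walk from \<open>v\<close> whose labels spell \<open>g\<close>. It is well defined near \<open>1\<close> for almost all \<open>v\<close>, and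
  injective there because \<open>u n\<close> is. The averages along the ultrafilter give a finitely additive limit
  distribution (locale \<open>ultralimit\<close>). Since the maps \<open>u n\<close> are statistically Lipschitz, the value at each
  \<open>g\<close> is tight, so that no mass is lost (\<open>tight_imp_law\<close>) and the extension theorem of Kolmogorov gives
  a probability measure \<open>\<nu>\<close> on maps from \<open>G\<close> to \<open>H\<close> (\<open>ex_limit_process\<close>).

  The move \<open>v \<mapsto> v g\<close> is almost a permutation of the vertices. Hence the map seen from \<open>v g\<close> has the same
  limit law as the one seen from \<open>v\<close>; in other words \<open>\<nu>\<close> has stationary increments
  (\<open>ex_stationary_law\<close>). Let \<open>\<mu>\<close> be the image of counting measure on \<open>H\<close> times \<open>\<nu>\<close> under
  \<open>(h, f) \<mapsto> h * f\<close>. It is invariant under \<open>H\<close> by construction. It is invariant under \<open>G\<close> because \<open>g * f\<close> is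
  an \<open>H\<close>-translate of the increments of \<open>f\<close> at \<open>inv g\<close>, whose law is \<open>\<nu>\<close> again
  (\<open>distr_\<mu>_arg_shift\<close>). Finally \<open>\<Omega>\<close> has at most the cardinality of the continuum, so the coupling
  can be moved to a set of real numbers.
\<close>

section \<open>Averages along an ultrafilter\<close>

text \<open>By compactness the sequence has a cluster point, the future limit, along \<open>U\<close>. Being an ultrafilter, \<open>U\<close> contains, for
  each neighbourhood of it, either the set of times spent there or its complement; a cluster point
  rules out the complement.\<close>
lemma ultrafilter_limit_exists:
  fixes x :: "nat \<Rightarrow> real"
  assumes "nonprincipal_ultrafilter U" and "\<And>n. x n \<in> {a..b}"
  shows "\<exists>l. (x \<longlongrightarrow> l) U"
proof -
  have U: "U \<noteq> bot" and ultra: "\<And>P. eventually P U \<or> eventually (\<lambda>i. \<not> P i) U"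
    using assms(1) by (auto simp: nonprincipal_ultrafilter_def)
  have "filtermap x U \<noteq> bot" using U by (simp add: filtermap_bot_iff)
  moreover have "eventually (\<lambda>y. y \<in> {a..b}) (filtermap x U)"
    using assms(2) by (simp add: eventually_filtermap)
  ultimately obtain l where l: "inf (nhds l) (filtermap x U) \<noteq> bot"
    using compact_Icc[of a b] unfolding compact_filter by blast
  have "eventually (\<lambda>n. x n \<in> S) U" if "open S" "l \<in> S" for S
  proof (rule ccontr)
    assume "\<not> eventually (\<lambda>n. x n \<in> S) U"
    then have "eventually (\<lambda>n. x n \<notin> S) U" using ultra by blast
    moreover have "eventually (\<lambda>y. y \<in> S) (nhds l)" using that by (rule eventually_nhds_in_open)
    ultimately have "eventually (\<lambda>y. False) (inf (nhds l) (filtermap x U))"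
      unfolding eventually_inf
      by (intro exI[of _ "\<lambda>y. y \<in> S"] exI[of _ "\<lambda>y. y \<notin> S"]) (auto simp: eventually_filtermap)
    then show False using l by (simp add: trivial_limit_def)
  qed
  then show ?thesis by (auto intro: topological_tendstoI)
qed

lemma nonprincipal_ultrafilter_le_sequentially:
  assumes "nonprincipal_ultrafilter U"
  shows "U \<le> sequentially"
proof -
  have ultra: "\<And>P. eventually P U \<or> eventually (\<lambda>i. \<not> P i) U"
    and np: "\<And>j. \<not> eventually (\<lambda>i. i = j) U"
    using assms by (auto simp: nonprincipal_ultrafilter_def)
  have "eventually (\<lambda>i. i \<noteq> j) U" for j using ultra[of "\<lambda>i. i = j"] np by blast
  then have "eventually (\<lambda>i. \<forall>j\<in>{..<m}. i \<noteq> j) U" for m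
    by (intro eventually_ball_finite) auto
  then have "eventually (\<lambda>i. m \<le> i) U" for m
    by (rule eventually_mono) (auto simp: not_less[symmetric])
  then show ?thesis
    by (simp add: at_top_def le_INF_iff le_principal)
qed

locale ultralimit =
  fixes U :: "nat filter" and V :: "nat \<Rightarrow> 'v set"
  assumes ultra: "nonprincipal_ultrafilter U"
    and finite_V: "finite (V n)"
    and nonempty_V: "eventually (\<lambda>n. V n \<noteq> {}) U"
begin

definition freq :: "(nat \<Rightarrow> 'v \<Rightarrow> bool) \<Rightarrow> nat \<Rightarrow> real" where
  "freq Q n = real (card {v \<in> V n. Q n v}) / real (card (V n))"

text \<open>A finitely additive probability on sequences of vertex properties: the one that the ultraproduct
  of the uniform measures gives to internal sets.\<close>
definition pr :: "(nat \<Rightarrow> 'v \<Rightarrow> bool) \<Rightarrow> real" where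
  "pr Q = Lim U (freq Q)"

lemma U_not_bot: "U \<noteq> bot"
  using ultra by (simp add: nonprincipal_ultrafilter_def)

lemma freq_bounds: "freq Q n \<in> {0..1}"
  using card_mono[OF finite_V, of "{v \<in> V n. Q n v}" n]
  by (auto simp: freq_def divide_le_eq_1)

lemma freq_tendsto: "(freq Q \<longlongrightarrow> pr Q) U"
proof -
  obtain l where l: "(freq Q \<longlongrightarrow> l) U"
    using ultrafilter_limit_exists[OF ultra, of "freq Q" 0 1] freq_bounds by blast
  then show ?thesis by (simp add: pr_def tendsto_Lim[OF U_not_bot])
qed

lemma pr_eqI: "(freq Q \<longlongrightarrow> l) U \<Longrightarrow> pr Q = l"
  unfolding pr_def by (rule tendsto_Lim[OF U_not_bot])

lemma pr_nonneg: "0 \<le> pr Q" and pr_le_1: "pr Q \<le> 1"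
  using freq_bounds
  by (auto intro: tendsto_lowerbound[OF freq_tendsto _ U_not_bot]
      tendsto_upperbound[OF freq_tendsto _ U_not_bot])

lemma pr_mono:
  assumes "\<And>n v. v \<in> V n \<Longrightarrow> Q n v \<Longrightarrow> Q' n v"
  shows "pr Q \<le> pr Q'"
proof -
  have "freq Q n \<le> freq Q' n" for n
    unfolding freq_def using assms finite_V
    by (intro divide_right_mono) (auto intro!: card_mono)
  then show ?thesis
    by (intro tendsto_le[OF U_not_bot freq_tendsto freq_tendsto]) auto
qed

lemma pr_cong:
  "(\<And>n v. v \<in> V n \<Longrightarrow> Q n v \<longleftrightarrow> Q' n v) \<Longrightarrow> pr Q = pr Q'"
  by (intro antisym pr_mono) auto

lemma pr_add:
  assumes "\<And>n v. v \<in> V n \<Longrightarrow> Q n v \<Longrightarrow> \<not> Q' n v"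
  shows "pr (\<lambda>n v. Q n v \<or> Q' n v) = pr Q + pr Q'"
proof (rule pr_eqI)
  have "freq (\<lambda>n v. Q n v \<or> Q' n v) n = freq Q n + freq Q' n" for n
  proof -
    have "{v \<in> V n. Q n v \<or> Q' n v} = {v \<in> V n. Q n v} \<union> {v \<in> V n. Q' n v}" by auto
    then have "card {v \<in> V n. Q n v \<or> Q' n v} = card {v \<in> V n. Q n v} + card {v \<in> V n. Q' n v}"
      using assms finite_V by (auto intro!: card_Un_disjoint)
    then show ?thesis by (simp add: freq_def add_divide_distrib)
  qed
  then show "(freq (\<lambda>n v. Q n v \<or> Q' n v) \<longlongrightarrow> pr Q + pr Q') U"
    using tendsto_add[OF freq_tendsto freq_tendsto] by presburger
qed

lemma pr_True: "pr (\<lambda>n v. True) = 1"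
proof (rule pr_eqI)
  have "eventually (\<lambda>n. freq (\<lambda>n v. True) n = 1) U"
    using nonempty_V by eventually_elim (use finite_V in \<open>auto simp: freq_def\<close>)
  then show "(freq (\<lambda>n v. True) \<longlongrightarrow> 1) U" by (rule tendsto_eventually)
qed

lemma pr_not: "pr (\<lambda>n v. \<not> Q n v) = 1 - pr Q"
proof -
  have "pr (\<lambda>n v. True) = pr (\<lambda>n v. Q n v \<or> \<not> Q n v)" by (rule pr_cong) auto
  also have "\<dots> = pr Q + pr (\<lambda>n v. \<not> Q n v)" by (rule pr_add) auto
  finally show ?thesis by (simp add: pr_True)
qed

lemma pr_False: "pr (\<lambda>n v. False) = 0"
  using pr_not[of "\<lambda>n v. True"] by (simp add: pr_True)

lemma pr_disj_le: "pr (\<lambda>n v. Q n v \<or> Q' n v) \<le> pr Q + pr Q'"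
proof -
  have "pr (\<lambda>n v. Q n v \<or> Q' n v) = pr (\<lambda>n v. Q n v \<or> (\<not> Q n v \<and> Q' n v))"
    by (rule pr_cong) auto
  also have "\<dots> = pr Q + pr (\<lambda>n v. \<not> Q n v \<and> Q' n v)" by (rule pr_add) auto
  also have "\<dots> \<le> pr Q + pr Q'" by (intro add_left_mono pr_mono) auto
  finally show ?thesis .
qed

lemma pr_conj_ge: "pr Q + pr Q' - 1 \<le> pr (\<lambda>n v. Q n v \<and> Q' n v)"
  using pr_disj_le[of "\<lambda>n v. \<not> Q n v" "\<lambda>n v. \<not> Q' n v"] pr_not[of "\<lambda>n v. Q n v \<and> Q' n v"]
  by (simp add: pr_not)

text \<open>Conditions of limiting frequency one may be assumed, as almost sure ones are in probability
  theory.\<close>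
lemma pr_cong_almost:
  assumes "pr R = 1" and "\<And>n v. v \<in> V n \<Longrightarrow> R n v \<Longrightarrow> Q n v \<longleftrightarrow> Q' n v"
  shows "pr Q = pr Q'"
proof -
  have *: "pr P = pr (\<lambda>n v. P n v \<and> R n v)" for P
    using pr_conj_ge[of P R] pr_mono[of "\<lambda>n v. P n v \<and> R n v" P] assms(1) by auto
  have "pr (\<lambda>n v. Q n v \<and> R n v) = pr (\<lambda>n v. Q' n v \<and> R n v)"
    using assms(2) by (intro pr_cong) auto
  then show ?thesis using *[of Q] *[of Q'] by simp
qed

text \<open>An injection of almost all of \<open>V n\<close> into \<open>V n\<close> is almost a permutation, and a permutation
  does not change the proportion of the points with a given property.\<close>
lemma pr_shift:
  assumes R: "pr R = 1"
    and inj: "\<And>n. inj_on (T n) {v \<in> V n. R n v}"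
    and into: "\<And>n v. v \<in> V n \<Longrightarrow> R n v \<Longrightarrow> T n v \<in> V n"
  shows "pr (\<lambda>n v. Q n (T n v)) = pr Q"
proof -
  have le: "pr (\<lambda>n v. Q n (T n v)) \<le> pr Q" for Q
  proof -
    have "pr (\<lambda>n v. Q n (T n v)) = pr (\<lambda>n v. Q n (T n v) \<and> R n v)"
      by (rule pr_cong_almost[OF R]) auto
    also have "\<dots> \<le> pr Q"
    proof (rule tendsto_le[OF U_not_bot freq_tendsto freq_tendsto], rule always_eventually, rule allI)
      fix n
      have "card {v \<in> V n. Q n (T n v) \<and> R n v} \<le> card {v \<in> V n. Q n v}"
        by (rule card_inj_on_le[where f = "T n"])
          (use inj[of n] into finite_V in \<open>auto simp: inj_on_def\<close>)
      then show "freq (\<lambda>n v. Q n (T n v) \<and> R n v) n \<le> freq Q n"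
        by (auto simp: freq_def intro!: divide_right_mono)
    qed
    finally show ?thesis .
  qed
  show ?thesis
    using le[of Q] le[of "\<lambda>n v. \<not> Q n v"] pr_not[of Q] pr_not[of "\<lambda>n v. Q n (T n v)"] by simp
qed

text \<open>Finitely additive mass can only fail to be countably additive by escaping from all finite
  sets; tightness forbids that.\<close>
lemma tight_imp_law:
  fixes X :: "nat \<Rightarrow> 'v \<Rightarrow> 'b"
  assumes tight: "\<And>e. e > 0 \<Longrightarrow> \<exists>F. finite F \<and> 1 - e < pr (\<lambda>n v. X n v \<in> F)"
  shows "\<exists>p :: 'b pmf. \<forall>A. measure_pmf.prob p A = pr (\<lambda>n v. X n v \<in> A)"
proof -
  define f where "f b = pr (\<lambda>n v. X n v = b)" for b
  have f_sum: "sum f F = pr (\<lambda>n v. X n v \<in> F)" if "finite F" for F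
    using that
  proof (induction F)
    case (insert b F)
    have "pr (\<lambda>n v. X n v \<in> insert b F) = pr (\<lambda>n v. X n v = b \<or> X n v \<in> F)" by simp
    also have "\<dots> = f b + pr (\<lambda>n v. X n v \<in> F)"
      unfolding f_def by (rule pr_add) (use insert.hyps in auto)
    finally show ?case using insert by simp
  qed (simp add: pr_False)
  have f_nonneg: "0 \<le> f b" for b by (simp add: f_def pr_nonneg)
  have summable: "f summable_on UNIV"
    by (rule nonneg_bounded_partial_sums_imp_summable_on[of _ _ 1])
      (auto simp: f_nonneg f_sum pr_le_1 intro!: eventually_finite_subsets_at_top_weakI)
  have "infsum f UNIV \<le> 1"
    by (rule infsum_le_finite_sums[OF summable]) (auto simp: f_sum pr_le_1)
  moreover have "1 \<le> infsum f UNIV"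
  proof (rule field_le_epsilon)
    fix e :: real assume "e > 0"
    then obtain F where F: "finite F" "1 - e < pr (\<lambda>n v. X n v \<in> F)" using tight by blast
    have "sum f F \<le> infsum f UNIV"
      by (rule finite_sum_le_infsum[OF summable F(1)]) (auto simp: f_nonneg)
    then show "1 \<le> infsum f UNIV + e" using F f_sum[OF F(1)] by simp
  qed
  ultimately have "infsum f UNIV = 1" by simp
  moreover have "Infinite_Set_Sum.abs_summable_on f UNIV"
    using summable f_nonneg by (simp flip: abs_summable_equivalent)
  ultimately have "(\<integral>\<^sup>+b. ennreal (f b) \<partial>count_space UNIV) = 1"
    using f_nonneg by (simp add: nn_integral_conv_infsetsum infsetsum_infsum)
  then have pmf: "pmf (embed_pmf f) b = f b" for b
    using f_nonneg by (intro pmf_embed_pmf)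
  have ge: "pr (\<lambda>n v. X n v \<in> A) \<le> measure_pmf.prob (embed_pmf f) A" for A
  proof (rule field_le_epsilon)
    fix e :: real assume "e > 0"
    then obtain F where F: "finite F" "1 - e < pr (\<lambda>n v. X n v \<in> F)" using tight by blast
    have "pr (\<lambda>n v. X n v \<in> A) \<le> pr (\<lambda>n v. X n v \<in> A \<inter> F \<or> X n v \<notin> F)"
      by (rule pr_mono) auto
    also have "\<dots> \<le> pr (\<lambda>n v. X n v \<in> A \<inter> F) + pr (\<lambda>n v. X n v \<notin> F)"
      by (rule pr_disj_le)
    also have "pr (\<lambda>n v. X n v \<in> A \<inter> F) = measure_pmf.prob (embed_pmf f) (A \<inter> F)"
      using F(1) by (simp add: measure_measure_pmf_finite pmf f_sum)
    also have "\<dots> \<le> measure_pmf.prob (embed_pmf f) A"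
      by (rule measure_pmf.finite_measure_mono) auto
    finally show "pr (\<lambda>n v. X n v \<in> A) \<le> measure_pmf.prob (embed_pmf f) A + e"
      using F(2) by (simp add: pr_not)
  qed
  have "measure_pmf.prob (embed_pmf f) A = pr (\<lambda>n v. X n v \<in> A)" for A
  proof -
    have "measure_pmf.prob (embed_pmf f) (- A) = 1 - measure_pmf.prob (embed_pmf f) A"
      using measure_pmf.prob_compl[of A "embed_pmf f"] unfolding Compl_eq_Diff_UNIV by simp
    then show ?thesis
      using ge[of A] ge[of "- A"] by (simp add: pr_not)
  qed
  then show ?thesis by blast
qed

end

section \<open>Countable powers of discrete spaces\<close>

lemma sets_PiM_count_space_finite:
  assumes "finite J" and "countable B" and "A \<subseteq> (\<Pi>\<^sub>E j\<in>J. B)"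
  shows "A \<in> sets (PiM J (\<lambda>_. count_space B))"
proof -
  have "countable A"
    using assms by (meson countable_PiE countable_subset)
  moreover have "{x} \<in> sets (PiM J (\<lambda>_. count_space B))" if "x \<in> A" for x
  proof -
    have x: "x \<in> (\<Pi>\<^sub>E j\<in>J. B)" using that assms(3) by blast
    have "{x} = (\<Pi>\<^sub>E j\<in>J. {x j})" 
      by (rule PiE_singleton[symmetric]) (use x in \<open>auto simp: PiE_def\<close>)
    moreover have "(\<Pi>\<^sub>E j\<in>J. {x j}) \<in> sets (PiM J (\<lambda>_. count_space B))"
      using x assms(1) by (intro sets_PiM_I_finite) auto
    ultimately show ?thesis by simp
  qed
  ultimately have "(\<Union>x\<in>A. {x}) \<in> sets (PiM J (\<lambda>_. count_space B))"
    by (intro sets.countable_UN') auto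
  then show ?thesis by simp
qed

lemma measurable_restrict_vimage:
  assumes "finite J" and "J \<subseteq> I" and "countable B"
  shows "{x \<in> space (PiM I (\<lambda>_. count_space B)). restrict x J \<in> A} \<in> sets (PiM I (\<lambda>_. count_space B))"
proof -
  have "A \<inter> (\<Pi>\<^sub>E j\<in>J. B) \<in> sets (PiM J (\<lambda>_. count_space B))"
    by (rule sets_PiM_count_space_finite) (use assms in auto)
  then have "(\<lambda>x. restrict x J) -` (A \<inter> (\<Pi>\<^sub>E j\<in>J. B)) \<inter> space (PiM I (\<lambda>_. count_space B))
      \<in> sets (PiM I (\<lambda>_. count_space B))"
    using measurable_restrict_subset[OF assms(2)] by (rule measurable_sets[rotated])
  moreover have "restrict x J \<in> (\<Pi>\<^sub>E j\<in>J. B)" if "x \<in> I \<rightarrow>\<^sub>E B" for x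
    using that assms(2) by auto
  then have "(\<lambda>x. restrict x J) -` (A \<inter> (\<Pi>\<^sub>E j\<in>J. B)) \<inter> space (PiM I (\<lambda>_. count_space B))
      = {x \<in> space (PiM I (\<lambda>_. count_space B)). restrict x J \<in> A}"
    unfolding space_PiM space_count_space by blast
  ultimately show ?thesis by simp
qed

abbreviation discrete_power :: "'i set \<Rightarrow> 'b set \<Rightarrow> ('i \<Rightarrow> 'b) topology" where
  "discrete_power I B \<equiv> product_topology (\<lambda>_. discrete_topology B) I"

definition cylinder :: "'i set \<Rightarrow> 'b set \<Rightarrow> 'i set \<Rightarrow> ('i \<Rightarrow> 'b) \<Rightarrow> ('i \<Rightarrow> 'b) set" where
  "cylinder I B J b = {x \<in> I \<rightarrow>\<^sub>E B. \<forall>j\<in>J. x j = b j}"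

lemma openin_cylinder:
  assumes "finite J" and "J \<subseteq> I"
  shows "openin (discrete_power I B) (cylinder I B J b)"
proof -
  have "cylinder I B J b = (\<Pi>\<^sub>E i\<in>I. if i \<in> J then B \<inter> {b i} else B)"
  proof (intro equalityI subsetI)
    fix x assume x: "x \<in> (\<Pi>\<^sub>E i\<in>I. if i \<in> J then B \<inter> {b i} else B)"
    have mem: "x i \<in> (if i \<in> J then B \<inter> {b i} else B)" if "i \<in> I" for i
      using x that by (rule PiE_mem)
    have "x i \<in> B" if "i \<in> I" for i using mem[OF that] by (auto split: if_splits)
    moreover have "x j = b j" if "j \<in> J" for j using mem[of j] that assms(2) by auto
    ultimately show "x \<in> cylinder I B J b" using x by (simp add: cylinder_def PiE_iff)
  qed (auto simp: cylinder_def PiE_iff)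
  moreover have "finite {i \<in> I. (if i \<in> J then B \<inter> {b i} else B) \<noteq> B}"
    by (rule finite_subset[OF _ assms(1)]) (auto split: if_splits)
  ultimately show ?thesis
    by (auto intro!: openin_PiE_gen[THEN iffD2] simp: Int_def)
qed

text \<open>A basic open set of the product constrains finitely many coordinates only, and in a discrete factor
  the strictest constraint is to be equal.\<close>
lemma cylinder_in_open:
  assumes "openin (discrete_power I B) W" and "x \<in> W"
  obtains J where "finite J" "J \<subseteq> I" "x \<in> cylinder I B J x" "cylinder I B J x \<subseteq> W"
proof -
  obtain N where N: "finite {i \<in> I. N i \<noteq> topspace (discrete_topology B)}"
    "x \<in> PiE I N" "PiE I N \<subseteq> W"
    using assms unfolding openin_product_topology_alt by blast
  define J where "J = {i \<in> I. N i \<noteq> B}"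
  have "x \<in> I \<rightarrow>\<^sub>E B" using assms openin_subset by fastforce
  moreover have "cylinder I B J x \<subseteq> PiE I N"
  proof
    fix y assume y: "y \<in> cylinder I B J x"
    then have "y i \<in> N i" if "i \<in> I" for i
      using that N(2) by (cases "i \<in> J") (auto simp: cylinder_def J_def PiE_iff)
    then show "y \<in> PiE I N" using y by (auto simp: cylinder_def PiE_iff)
  qed
  ultimately show thesis
    using N by (intro that[of J]) (auto simp: J_def cylinder_def)
qed

definition cylinders :: "'i set \<Rightarrow> 'b set \<Rightarrow> ('i \<Rightarrow> 'b) set set" where
  "cylinders I B = (\<lambda>(J, b). cylinder I B J b) ` (SIGMA J:{J. J \<subseteq> I \<and> finite J}. J \<rightarrow>\<^sub>E B)"

lemma countable_cylinders:
  assumes "countable I" and "countable B"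
  shows "countable (cylinders I B)"
proof -
  have "countable {J. J \<subseteq> I \<and> finite J}"
    using countable_Collect_finite_subset[OF assms(1)] by (simp add: conj_commute)
  then show ?thesis
    unfolding cylinders_def using assms
    by (intro countable_image countable_SIGMA countable_PiE) auto
qed

lemma cylindersE:
  assumes "C \<in> cylinders I B"
  obtains J b where "finite J" "J \<subseteq> I" "b \<in> J \<rightarrow>\<^sub>E B" "C = cylinder I B J b"
  using assms by (auto simp: cylinders_def)

lemma cylinders_base:
  assumes W: "openin (discrete_power I B) W" "x \<in> W"
  shows "\<exists>C\<in>cylinders I B. x \<in> C \<and> C \<subseteq> W"
proof -
  obtain J where J: "finite J" "J \<subseteq> I" "x \<in> cylinder I B J x" "cylinder I B J x \<subseteq> W"
    using cylinder_in_open[OF W] by metis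
  have "cylinder I B J x = cylinder I B J (restrict x J)" by (auto simp: cylinder_def)
  moreover have "restrict x J \<in> J \<rightarrow>\<^sub>E B"
    using J by (auto simp: cylinder_def PiE_iff subset_iff)
  ultimately have "cylinder I B J x \<in> cylinders I B"
    unfolding cylinders_def using J by force
  then show ?thesis using J by blast
qed

text \<open>Both sides are generated by the cylinders, of which there are countably many.\<close>
lemma sets_PiM_count_space_eq_borel:
  assumes "countable I" and "countable B"
  shows "sets (PiM I (\<lambda>_. count_space B)) = sigma_sets (I \<rightarrow>\<^sub>E B) {W. openin (discrete_power I B) W}"
proof (rule antisym)
  have "\<And>W. openin (discrete_power I B) W \<Longrightarrow> W \<subseteq> I \<rightarrow>\<^sub>E B"
    using openin_subset by fastforce
  then have opens: "{W. openin (discrete_power I B) W} \<subseteq> Pow (I \<rightarrow>\<^sub>E B)" by blast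
  have "{f \<in> I \<rightarrow>\<^sub>E B. f i \<in> A} \<in> {W. openin (discrete_power I B) W}"
    if "i \<in> I" "A \<subseteq> B" for i A
    using openin_continuous_map_preimage[OF continuous_map_product_projection[OF that(1),
          of "\<lambda>_. discrete_topology B"], of A] that
    by simp
  then have *: "{f \<in> I \<rightarrow>\<^sub>E B. f i \<in> A} \<in> sigma_sets (I \<rightarrow>\<^sub>E B) {W. openin (discrete_power I B) W}"
    if "i \<in> I" "A \<subseteq> B" for i A
    using that by (intro sigma_sets.Basic)
  show "sets (PiM I (\<lambda>_. count_space B)) \<subseteq> sigma_sets (I \<rightarrow>\<^sub>E B) {W. openin (discrete_power I B) W}"
    unfolding sets_PiM_single space_count_space sets_count_space
    using * by (intro sigma_sets_mono) blast
next
  have cyl: "C \<in> sets (PiM I (\<lambda>_. count_space B))" if C: "C \<in> cylinders I B" for C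
  proof -
    obtain J b where J: "finite J" "J \<subseteq> I" "b \<in> J \<rightarrow>\<^sub>E B" "C = cylinder I B J b"
      using C by (rule cylindersE)
    have "C = {x \<in> space (PiM I (\<lambda>_. count_space B)). restrict x J \<in> {b}}"
      using J by (auto simp: cylinder_def space_PiM fun_eq_iff PiE_iff extensional_def restrict_def)
    then show ?thesis
      using measurable_restrict_vimage[OF J(1,2) assms(2), where A = "{b}"] by (simp only:)
  qed
  have "W \<in> sets (PiM I (\<lambda>_. count_space B))" if W: "openin (discrete_power I B) W" for W
  proof -
    have "W = \<Union>{C \<in> cylinders I B. C \<subseteq> W}" using cylinders_base[OF W] by blast
    moreover have "\<Union>{C \<in> cylinders I B. C \<subseteq> W} \<in> sets (PiM I (\<lambda>_. count_space B))"
      using countable_cylinders[OF assms] cyl by (intro sets.countable_Union) auto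
    ultimately show ?thesis by metis
  qed
  then show "sigma_sets (I \<rightarrow>\<^sub>E B) {W. openin (discrete_power I B) W} \<subseteq> sets (PiM I (\<lambda>_. count_space B))"
    using sets.sigma_sets_subset[of "{W. openin (discrete_power I B) W}" "PiM I (\<lambda>_. count_space B)"]
    by (auto simp: space_PiM)
qed

lemma standard_borel_closed_in_power:
  assumes I: "countable I" and B: "countable B"
    and closed: "closedin (discrete_power I B) \<Omega>"
    and M: "sets M = sets (PiM I (\<lambda>_. count_space B))"
  shows "standard_borel (restrict_space M \<Omega>)"
  unfolding standard_borel_def
proof (intro exI conjI)
  let ?T = "discrete_power I B"
  have \<Omega>: "\<Omega> \<subseteq> I \<rightarrow>\<^sub>E B" using closedin_subset[OF closed] by simp
  have space_M: "space M = I \<rightarrow>\<^sub>E B"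
    using sets_eq_imp_space_eq[OF M] by (simp add: space_PiM)
  show "completely_metrizable_space (subtopology ?T \<Omega>)"
    using I closed by (intro completely_metrizable_space_closedin)
      (auto simp: completely_metrizable_space_product_topology
        completely_metrizable_space_discrete_topology)
  have "second_countable ?T"
    unfolding second_countable_def
    using countable_cylinders[OF I B] cylinders_base[where I = I and B = B]
    by (intro exI[of _ "cylinders I B"]) (auto elim!: cylindersE intro: openin_cylinder)
  then show "second_countable (subtopology ?T \<Omega>)" by (rule second_countable_subtopology)
  show "topspace (subtopology ?T \<Omega>) = space (restrict_space M \<Omega>)"
    using \<Omega> by (auto simp: space_restrict_space space_M)
  have "(I \<rightarrow>\<^sub>E B) - \<Omega> \<in> sigma_sets (I \<rightarrow>\<^sub>E B) {W. openin ?T W}"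
    using closed by (intro sigma_sets.Basic) (simp add: closedin_def)
  then have "(I \<rightarrow>\<^sub>E B) - ((I \<rightarrow>\<^sub>E B) - \<Omega>) \<in> sigma_sets (I \<rightarrow>\<^sub>E B) {W. openin ?T W}"
    by (rule sigma_sets.Compl)
  then have "\<Omega> \<in> sigma_sets (I \<rightarrow>\<^sub>E B) {W. openin ?T W}"
    using \<Omega> by (simp add: double_diff)
  then have "(\<inter>) \<Omega> ` sigma_sets (I \<rightarrow>\<^sub>E B) {W. openin ?T W}
      = sigma_sets \<Omega> ((\<inter>) \<Omega> ` {W. openin ?T W})"
    using \<Omega> by (rule sigma_sets_Int)
  moreover have "(\<inter>) \<Omega> ` {W. openin ?T W} = {A. openin (subtopology ?T \<Omega>) A}"
    by (auto simp: openin_subtopology)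
  ultimately show "sets (restrict_space M \<Omega>)
      = sigma_sets (space (restrict_space M \<Omega>)) {A. openin (subtopology ?T \<Omega>) A}"
    using \<Omega> by (simp add: sets_restrict_space M sets_PiM_count_space_eq_borel[OF I B]
        space_restrict_space space_M Int_absorb2)
qed

text \<open>A failure of injectivity is seen at two indices, so it persists on a cylinder.\<close>
lemma closedin_inj_maps:
  "closedin (discrete_power I B) {x \<in> I \<rightarrow>\<^sub>E B. inj_on x I}"
  unfolding closedin_def
proof
  let ?N = "topspace (discrete_power I B) - {x \<in> I \<rightarrow>\<^sub>E B. inj_on x I}"
  show "openin (discrete_power I B) ?N"
  proof (subst openin_subopen, rule ballI)
    fix x assume x: "x \<in> ?N"
    then obtain i j where ij: "i \<in> I" "j \<in> I" "i \<noteq> j" "x i = x j" by (auto simp: inj_on_def)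
    have "openin (discrete_power I B) (cylinder I B {i, j} x)"
      using ij by (intro openin_cylinder) auto
    moreover have "x \<in> cylinder I B {i, j} x" using x by (auto simp: cylinder_def)
    moreover have "cylinder I B {i, j} x \<subseteq> ?N"
      using ij by (auto simp: cylinder_def inj_on_def)
    ultimately show "\<exists>T. openin (discrete_power I B) T \<and> x \<in> T \<and> T \<subseteq> ?N" by blast
  qed
qed auto

section \<open>The limit of a tight sequence of random maps\<close>

context ultralimit
begin

lemma pr_bex_le_sum:
  "finite J \<Longrightarrow> pr (\<lambda>n v. \<exists>j\<in>J. Q j n v) \<le> (\<Sum>j\<in>J. pr (Q j))"
proof (induction J rule: finite_induct)
  case (insert j J)
  have "pr (\<lambda>n v. \<exists>j\<in>insert j J. Q j n v) \<le> pr (Q j) + pr (\<lambda>n v. \<exists>j\<in>J. Q j n v)"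
    using pr_disj_le[of "Q j" "\<lambda>n v. \<exists>j\<in>J. Q j n v"] by simp
  then show ?case using insert by simp
qed (simp add: pr_False)

lemma tight_restrict:
  fixes X :: "nat \<Rightarrow> 'v \<Rightarrow> 'i \<Rightarrow> 'b"
  assumes J: "finite J"
    and tight: "\<And>i e. i \<in> J \<Longrightarrow> e > 0 \<Longrightarrow> \<exists>F. finite F \<and> 1 - e < pr (\<lambda>n v. X n v i \<in> F)"
    and "e > 0"
  shows "\<exists>F. finite F \<and> 1 - e < pr (\<lambda>n v. restrict (X n v) J \<in> F)"
proof -
  \<comment> \<open>adding one keeps the quotient positive and makes the final estimate strict, also for empty \<open>J\<close>\<close>
  define d where "d = e / (real (card J) + 1)"
  have d: "d > 0" using \<open>e > 0\<close> by (simp add: d_def)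
  obtain F where F: "\<And>i. i \<in> J \<Longrightarrow> finite (F i) \<and> 1 - d < pr (\<lambda>n v. X n v i \<in> F i)"
    using tight[OF _ d] by metis
  have "1 - pr (\<lambda>n v. restrict (X n v) J \<in> PiE J F) = pr (\<lambda>n v. \<not> restrict (X n v) J \<in> PiE J F)"
    by (simp add: pr_not)
  also have "\<dots> = pr (\<lambda>n v. \<exists>j\<in>J. X n v j \<notin> F j)"
    by (rule pr_cong) (auto simp: PiE_iff)
  also have "\<dots> \<le> (\<Sum>j\<in>J. pr (\<lambda>n v. X n v j \<notin> F j))" by (rule pr_bex_le_sum[OF J])
  also have "\<dots> \<le> (\<Sum>j\<in>J. d)"
    using F by (intro sum_mono) (auto simp: pr_not less_imp_le algebra_simps)
  also have "\<dots> < e"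
    using \<open>e > 0\<close> by (simp add: d_def field_simps)
  finally show ?thesis using F J by (intro exI[of _ "PiE J F"]) (auto intro: finite_PiE)
qed

text \<open>Each finite family of values has a limit law by tightness. These laws are consistent, since all of
  them are averages of the same random maps; so they are the marginals of one measure. The extension
  theorem wants values in a Polish space, whence the detour through codes in the reals.\<close>
theorem ex_limit_process:
  fixes X :: "nat \<Rightarrow> 'v \<Rightarrow> 'i \<Rightarrow> 'b"
  assumes B: "countable B" "B \<noteq> {}"
    and in_B: "\<And>n v i. v \<in> V n \<Longrightarrow> i \<in> I \<Longrightarrow> X n v i \<in> B"
    and tight: "\<And>i e. i \<in> I \<Longrightarrow> e > 0 \<Longrightarrow> \<exists>F. finite F \<and> 1 - e < pr (\<lambda>n v. X n v i \<in> F)"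
  shows "\<exists>\<nu>. prob_space \<nu> \<and> sets \<nu> = sets (PiM I (\<lambda>_. count_space B)) \<and>
    (\<forall>J A. finite J \<longrightarrow> J \<subseteq> I \<longrightarrow>
      measure \<nu> {x \<in> space \<nu>. restrict x J \<in> A} = pr (\<lambda>n v. restrict (X n v) J \<in> A))"
proof -
  define enc where "enc b = real (to_nat_on B b)" for b
  define dec where "dec r = from_nat_into B (nat \<lfloor>r\<rfloor>)" for r :: real
  have dec_enc: "dec (enc b) = b" if "b \<in> B" for b
    using that B by (simp add: enc_def dec_def)
  have dec_in: "dec r \<in> B" for r
    using B by (simp add: dec_def from_nat_into)
  have meas_dec: "dec \<in> borel \<rightarrow>\<^sub>M count_space B"
  proof -
    have "(\<lambda>k::int. from_nat_into B (nat k)) \<in> count_space UNIV \<rightarrow>\<^sub>M count_space B"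
      using B by (auto simp: from_nat_into)
    then show ?thesis
      unfolding dec_def by (rule measurable_compose[rotated]) measurable
  qed
  define Y where "Y n v J = (\<lambda>j\<in>J. enc (X n v j))" for n v J
  have "\<exists>p. \<forall>A. measure_pmf.prob p A = pr (\<lambda>n v. Y n v J \<in> A)" if J: "finite J" "J \<subseteq> I" for J
  proof (rule tight_imp_law)
    fix e :: real assume "e > 0"
    then obtain F where F: "finite F" "1 - e < pr (\<lambda>n v. restrict (X n v) J \<in> F)"
      using tight_restrict[OF J(1)] tight J(2) by blast
    have "pr (\<lambda>n v. restrict (X n v) J \<in> F) \<le> pr (\<lambda>n v. Y n v J \<in> (\<lambda>f. \<lambda>j\<in>J. enc (f j)) ` F)"
    proof (rule pr_mono)
      fix n v
      have "Y n v J = (\<lambda>f. \<lambda>j\<in>J. enc (f j)) (restrict (X n v) J)" by (auto simp: Y_def)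
      moreover assume "restrict (X n v) J \<in> F"
      ultimately show "Y n v J \<in> (\<lambda>f. \<lambda>j\<in>J. enc (f j)) ` F" by blast
    qed
    then show "\<exists>F. finite F \<and> 1 - e < pr (\<lambda>n v. Y n v J \<in> F)"
      using F by (intro exI[of _ "(\<lambda>f. \<lambda>j\<in>J. enc (f j)) ` F"]) auto
  qed
  then obtain law where law: "\<And>J A. finite J \<Longrightarrow> J \<subseteq> I \<Longrightarrow>
      measure_pmf.prob (law J) A = pr (\<lambda>n v. Y n v J \<in> A)"
    by metis
  define P where "P J = distr (measure_pmf (law J)) (PiM J (\<lambda>_. borel)) (\<lambda>f. restrict f J)"
    for J
  have meas_r: "(\<lambda>f. restrict f J) \<in> measure_pmf p \<rightarrow>\<^sub>M PiM J (\<lambda>_. borel)"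
    for J and p :: "('i \<Rightarrow> real) pmf"
    by (auto simp: measurable_def space_PiM)
  have "projective_family I P (\<lambda>_. borel)"
  proof (rule projective_family.intro)
    fix J K :: "'i set" assume JK: "J \<subseteq> K" "finite K" "K \<subseteq> I"
    have fin: "finite J" "J \<subseteq> I" using JK finite_subset by auto
    have "law J = map_pmf (\<lambda>f. restrict f J) (law K)"
    proof (rule pmf_eqI)
      fix f
      have "pmf (law J) f = pr (\<lambda>n v. Y n v J \<in> {f})"
        using law[OF fin, of "{f}"] by (simp add: measure_pmf_single)
      also have "\<dots> = pr (\<lambda>n v. Y n v K \<in> (\<lambda>f. restrict f J) -` {f})"
      proof (rule pr_cong)
        fix n v
        have "restrict (Y n v K) J = Y n v J" using JK(1) by (auto simp: Y_def fun_eq_iff)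
        then show "Y n v J \<in> {f} \<longleftrightarrow> Y n v K \<in> (\<lambda>f. restrict f J) -` {f}" by simp
      qed
      also have "\<dots> = pmf (map_pmf (\<lambda>f. restrict f J) (law K)) f"
        using law[OF JK(2,3)] by (simp add: pmf_map)
      finally show "pmf (law J) f = pmf (map_pmf (\<lambda>f. restrict f J) (law K)) f" .
    qed
    then have "P J = distr (measure_pmf (law K)) (PiM J (\<lambda>_. borel)) (\<lambda>f. restrict f J)"
      unfolding P_def
      by (simp add: map_pmf_rep_eq) (subst distr_distr, auto simp: o_def space_PiM)
    also have "\<dots> = distr (P K) (PiM J (\<lambda>_. borel)) (\<lambda>f. restrict f J)"
      unfolding P_def using JK(1)
      by (subst distr_distr) (auto simp: o_def Int_absorb1 space_PiM intro!: measurable_restrict_subset)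
    finally show "P J = distr (P K) (PiM J (\<lambda>_. borel)) (\<lambda>f. restrict f J)" .
  next
    fix J assume "finite J" "J \<subseteq> I"
    show "prob_space (P J)"
      unfolding P_def by (rule measure_pmf.prob_space_distr[OF meas_r])
  qed
  then interpret P: polish_projective I P by (simp add: polish_projective_def)
  let ?D = "\<lambda>J f. \<lambda>j\<in>J. dec (f j)"
  have meas_D: "?D J \<in> PiM J (\<lambda>_. borel) \<rightarrow>\<^sub>M PiM J (\<lambda>_. count_space B)" for J
    by (intro measurable_restrict measurable_compose[OF _ meas_dec] measurable_component_singleton)
  have meas_DI: "?D I \<in> P.lim \<rightarrow>\<^sub>M PiM I (\<lambda>_. count_space B)"
    using meas_D[of I] by (simp cong: measurable_cong_sets)
  define \<nu> where "\<nu> = distr P.lim (PiM I (\<lambda>_. count_space B)) (?D I)"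
  show ?thesis
  proof (intro exI[of _ \<nu>] conjI allI impI)
    show "prob_space \<nu>" unfolding \<nu>_def by (rule P.P.prob_space_distr[OF meas_DI])
    show "sets \<nu> = sets (PiM I (\<lambda>_. count_space B))" by (simp add: \<nu>_def)
    fix J A assume J: "finite J" "J \<subseteq> I"
    let ?E = "{x \<in> space (PiM I (\<lambda>_. count_space B)). restrict x J \<in> A}"
    let ?Z = "?D J -` (A \<inter> (\<Pi>\<^sub>E j\<in>J. B)) \<inter> space (PiM J (\<lambda>_. borel))"
    have Z: "?Z \<in> sets (PiM J (\<lambda>_. borel))"
      by (rule measurable_sets[OF meas_D])
        (use J B in \<open>auto intro: sets_PiM_count_space_finite\<close>)
    have "measure \<nu> ?E = measure P.lim (?D I -` ?E \<inter> space P.lim)"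
      unfolding \<nu>_def by (rule measure_distr[OF meas_DI measurable_restrict_vimage[OF J B(1)]])
    also have "?D I -` ?E \<inter> space P.lim = prod_emb I (\<lambda>_. borel) J ?Z"
    proof -
      have "restrict (?D I f) J = ?D J (restrict f J)" for f
        using J(2) by (auto simp: fun_eq_iff)
      moreover have "?D K f \<in> K \<rightarrow>\<^sub>E B" for K f using dec_in by auto
      moreover have "restrict f J \<in> space (PiM J (\<lambda>_. borel))" for f :: "'i \<Rightarrow> real"
        by (simp add: space_PiM)
      ultimately show ?thesis
        unfolding prod_emb_def P.space_lim space_PiM space_count_space vimage_def
        by (auto simp: set_eq_iff space_PiM Pi_iff dec_in)
    qed
    also have "measure P.lim \<dots> = measure (P J) ?Z"
      by (rule P.measure_lim_emb[OF J(2,1) Z])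
    also have "\<dots> = measure_pmf.prob (law J) ((\<lambda>f. restrict f J) -` ?Z)"
      unfolding P_def by (subst measure_distr[OF meas_r Z]) simp
    also have "\<dots> = pr (\<lambda>n v. Y n v J \<in> (\<lambda>f. restrict f J) -` ?Z)"
      by (rule law[OF J])
    also have "\<dots> = pr (\<lambda>n v. restrict (X n v) J \<in> A)"
    proof (rule pr_cong)
      fix n v assume v: "v \<in> V n"
      have "?D J (restrict (Y n v J) J) = restrict (X n v) J"
        using in_B[OF v] J(2) by (auto simp: Y_def dec_enc fun_eq_iff)
      moreover have "restrict (X n v) J \<in> (\<Pi>\<^sub>E j\<in>J. B)" using in_B[OF v] J(2) by auto
      ultimately show "Y n v J \<in> (\<lambda>f. restrict f J) -` ?Z \<longleftrightarrow> restrict (X n v) J \<in> A"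
        by (simp add: space_PiM)
    qed
    finally have "measure \<nu> ?E = pr (\<lambda>n v. restrict (X n v) J \<in> A)" .
    moreover have "space \<nu> = space (PiM I (\<lambda>_. count_space B))" by (simp add: \<nu>_def)
    ultimately show "measure \<nu> {x \<in> space \<nu>. restrict x J \<in> A} = pr (\<lambda>n v. restrict (X n v) J \<in> A)"
      by (simp only:)
  qed
qed

end

section \<open>Words and walks\<close>

fun letter :: "('g, 'm) monoid_scheme \<Rightarrow> 'g \<times> bool \<Rightarrow> 'g" where
  "letter G (s, b) = (if b then s else inv\<^bsub>G\<^esub> s)"

definition word_value :: "('g, 'm) monoid_scheme \<Rightarrow> ('g \<times> bool) list \<Rightarrow> 'g" where
  "word_value G w = foldr (mult G) (map (letter G) w) \<one>\<^bsub>G\<^esub>"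

lemma word_value_Nil [simp]: "word_value G [] = \<one>\<^bsub>G\<^esub>"
  by (simp add: word_value_def)

lemma word_value_Cons [simp]: "word_value G (a # w) = letter G a \<otimes>\<^bsub>G\<^esub> word_value G w"
  by (simp add: word_value_def)

abbreviation words :: "'l set \<Rightarrow> ('l \<times> bool) list set" where
  "words S \<equiv> lists (S \<times> UNIV)"

context group
begin

lemma letter_closed: "S \<subseteq> carrier G \<Longrightarrow> a \<in> S \<times> UNIV \<Longrightarrow> letter G a \<in> carrier G"
  by (cases a) auto

lemma word_value_closed:
  assumes "S \<subseteq> carrier G"
  shows "w \<in> words S \<Longrightarrow> word_value G w \<in> carrier G"
  by (induction w) (auto intro!: m_closed letter_closed[OF assms])

lemma word_value_append:
  assumes "S \<subseteq> carrier G" "w \<in> words S" "w' \<in> words S"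
  shows "word_value G (w @ w') = word_value G w \<otimes> word_value G w'"
  using assms(2)
proof (induction w)
  case (Cons a w)
  then show ?case
    using assms(1,3) by (simp add: m_assoc letter_closed word_value_closed)
qed (use assms in \<open>simp add: word_value_closed\<close>)

lemma generate_word:
  assumes "S \<subseteq> carrier G" and "g \<in> generate G S"
  shows "\<exists>w \<in> words S. word_value G w = g"
  using assms(2)
proof induction
  case one
  show ?case by (intro bexI[of _ "[]"]) auto
next
  case (incl s)
  then show ?case using assms(1) by (intro bexI[of _ "[(s, True)]"]) auto
next
  case (inv s)
  then show ?case using assms(1) by (intro bexI[of _ "[(s, False)]"]) auto
next
  case (eng g h)
  then obtain w w' where "w \<in> words S" "word_value G w = g" "w' \<in> words S" "word_value G w' = h"
    by blast
  then show ?case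
    using word_value_append[OF assms(1)] by (intro bexI[of _ "w @ w'"]) auto
qed

lemma countable_carrier:
  assumes "finite S" "S \<subseteq> carrier G" "generate G S = carrier G"
  shows "countable (carrier G)"
proof -
  have "countable (words S)"
    using assms(1) by (intro countable_lists countable_SIGMA) (auto intro: countable_finite)
  moreover have "carrier G \<subseteq> word_value G ` words S"
    using generate_word[OF assms(2)] assms(3) by blast
  ultimately show ?thesis by (meson countable_image countable_subset)
qed

text \<open>The word length ranges over words in group elements, so a word in signed letters is first
  replaced by the list of the values of its letters.\<close>
lemma finite_word_length_le:
  assumes "finite S" "S \<subseteq> carrier G" "generate G S = carrier G"
  shows "finite {h \<in> carrier G. word_length G S h \<le> N}"
proof -
  let ?T = "S \<union> m_inv G ` S"
  have "{h \<in> carrier G. word_length G S h \<le> N}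
      \<subseteq> (\<lambda>w. foldr (mult G) w \<one>) ` {w. set w \<subseteq> ?T \<and> length w \<le> N}"
  proof clarsimp
    fix h assume h: "h \<in> carrier G" "word_length G S h \<le> N"
    obtain w where w: "w \<in> words S" "word_value G w = h"
      using generate_word[OF assms(2)] assms(3) h by blast
    have "set (map (letter G) w) \<subseteq> ?T"
      using w(1) by fastforce
    then have "\<exists>k w. length w = k \<and> set w \<subseteq> ?T \<and> foldr (mult G) w \<one> = h"
      using w(2) unfolding word_value_def by blast
    then have "\<exists>w. length w = word_length G S h \<and> set w \<subseteq> ?T \<and> foldr (mult G) w \<one> = h"
      unfolding word_length_def by (rule LeastI_ex)
    then show "h \<in> (\<lambda>w. foldr (mult G) w \<one>) ` {w. set w \<subseteq> ?T \<and> length w \<le> N}"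
      using h(2) by auto
  qed
  moreover have "finite {w. set w \<subseteq> ?T \<and> length w \<le> N}"
    using assms(1) by (intro finite_lists_length_le) auto
  ultimately show ?thesis by (meson finite_imageI finite_subset)
qed

end

fun edge_step :: "('v, 'l) lgraph \<Rightarrow> 'l \<times> bool \<Rightarrow> 'v \<Rightarrow> 'v \<Rightarrow> bool" where
  "edge_step X (s, b) x y = ((if b then (x, s, y) else (y, s, x)) \<in> edges X)"

fun walk :: "('v, 'l) lgraph \<Rightarrow> ('l \<times> bool) list \<Rightarrow> 'v \<Rightarrow> 'v \<Rightarrow> bool" where
  "walk X [] x y \<longleftrightarrow> x = y"
| "walk X (a # w) x y \<longleftrightarrow> (\<exists>z. edge_step X a x z \<and> walk X w z y)"

lemma walk_append: "walk X (w @ w') x y \<longleftrightarrow> (\<exists>z. walk X w x z \<and> walk X w' z y)"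
  by (induction w arbitrary: x) auto

lemma walk_adj: "walk X w x y \<Longrightarrow> (x, y) \<in> adj X ^^ length w"
proof (induction w arbitrary: x)
  case (Cons a w)
  then obtain z where "edge_step X a x z" "walk X w z y" by auto
  then have "(x, z) \<in> adj X" "(z, y) \<in> adj X ^^ length w"
    using Cons.IH by (cases a; auto simp: adj_def split: if_splits)+
  then show ?case by (auto intro: relpow_Suc_I2 simp del: relpow.simps)
qed simp

lemma walk_verts:
  assumes "edges X \<subseteq> verts X \<times> S \<times> verts X"
  shows "walk X w x y \<Longrightarrow> x \<in> verts X \<Longrightarrow> y \<in> verts X"
proof (induction w arbitrary: x)
  case (Cons a w)
  then obtain z where z: "edge_step X a x z" "walk X w z y" by auto
  then have "z \<in> verts X" using assms by (cases a) (auto split: if_splits)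
  then show ?case using Cons.IH z by blast
qed simp

lemma walk_in_graph_ball:
  assumes "walk X w x y" "y \<in> verts X" "real (length w) \<le> r"
  shows "y \<in> graph_ball X x r"
proof -
  have "graph_dist X x y \<le> enat (length w)"
    unfolding graph_dist_def using walk_adj[OF assms(1)] by (intro INF_lower) simp
  then have "ereal_of_enat (graph_dist X x y) \<le> ereal (real (length w))"
    by (metis ereal_of_enat_le_iff ereal_of_enat_simps(1))
  also have "\<dots> \<le> ereal r" using assms(3) by simp
  finally show ?thesis using assms(2) by (simp add: graph_ball_def)
qed

lemma edge_step_cayley:
  assumes "group G" "S \<subseteq> carrier G" "a \<in> S \<times> UNIV" "x \<in> carrier G"
  shows "edge_step (cayley_graph G S) a x y \<longleftrightarrow> y = x \<otimes>\<^bsub>G\<^esub> letter G a"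
proof -
  interpret group G by fact
  obtain s b where a: "a = (s, b)" "s \<in> S" using assms(3) by auto
  then have s: "s \<in> carrier G" using assms(2) by auto
  have "(y \<in> carrier G \<and> x = y \<otimes>\<^bsub>G\<^esub> s) \<longleftrightarrow> y = x \<otimes>\<^bsub>G\<^esub> inv\<^bsub>G\<^esub> s"
    using s assms(4) by (auto simp: m_assoc)
  then show ?thesis using a s assms(4) by (cases b) (auto simp: cayley_graph_def)
qed

lemma walk_cayley:
  assumes "group G" "S \<subseteq> carrier G"
  shows "w \<in> words S \<Longrightarrow> x \<in> carrier G \<Longrightarrow> walk (cayley_graph G S) w x (x \<otimes>\<^bsub>G\<^esub> word_value G w)"
proof (induction w arbitrary: x)
  case Nil
  then show ?case using assms(1) by (simp add: group.is_monoid monoid.r_one)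
next
  case (Cons a w)
  interpret group G by fact
  have a: "a \<in> S \<times> UNIV" "w \<in> words S" using Cons.prems by auto
  then have l: "letter G a \<in> carrier G" "word_value G w \<in> carrier G"
    using assms letter_closed word_value_closed by blast+
  then show ?case
    using Cons.IH[OF a(2), of "x \<otimes>\<^bsub>G\<^esub> letter G a"] Cons.prems a assms
    by (simp add: edge_step_cayley[OF assms a(1)] m_assoc del: letter.simps)
qed

text \<open>An isomorphism onto a ball of the Cayley graph carries walks labeled by \<open>w\<close> to such walks, of
  which there is only one in the Cayley graph.\<close>
lemma good_vert_walks:
  assumes G: "group G" "S \<subseteq> carrier G" and X: "finite_lgraph_over S X"
    and x: "x \<in> good_verts G S X r"
  obtains f where "inj_on f (graph_ball X x r)"
    and "\<And>w. w \<in> words S \<Longrightarrow> real (length w) \<le> r \<Longrightarrow> \<exists>y. walk X w x y"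
    and "\<And>w y. w \<in> words S \<Longrightarrow> real (length w) \<le> r \<Longrightarrow> walk X w x y \<Longrightarrow>
      y \<in> graph_ball X x r \<and> f y = word_value G w"
proof -
  interpret group G by fact
  let ?C = "cayley_graph G S"
  have xV: "x \<in> verts X" using x by (simp add: good_verts_def)
  have E: "edges X \<subseteq> verts X \<times> S \<times> verts X" using X by (simp add: finite_lgraph_over_def)
  obtain f where bij: "bij_betw f (graph_ball X x r) (graph_ball ?C \<one>\<^bsub>G\<^esub> r)" and fx: "f x = \<one>\<^bsub>G\<^esub>"
    and iso: "\<And>u v s. u \<in> graph_ball X x r \<Longrightarrow> v \<in> graph_ball X x r \<Longrightarrow>
      (u, s, v) \<in> edges X \<longleftrightarrow> (f u, s, f v) \<in> edges ?C"
    using x unfolding good_verts_def ball_iso_def by blast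
  have step: "edge_step X a u v \<longleftrightarrow> edge_step ?C a (f u) (f v)"
    if "u \<in> graph_ball X x r" "v \<in> graph_ball X x r" for a u v
    using iso that by (cases a) auto
  have main: "(\<exists>y. walk X w x y) \<and>
      (\<forall>y. walk X w x y \<longrightarrow> y \<in> graph_ball X x r \<and> f y = word_value G w)"
    if "w \<in> words S" "real (length w) \<le> r" for w
    using that
  proof (induction w rule: rev_induct)
    case Nil
    then have "x \<in> graph_ball X x r"
      using walk_in_graph_ball[of X "[]" x x r] xV by simp
    then show ?case using fx by simp
  next
    case (snoc a w)
    have w: "w \<in> words S" "real (length w) \<le> r" and a: "a \<in> S \<times> UNIV" and aw: "w @ [a] \<in> words S"
      using snoc.prems by auto
    have val: "word_value G (w @ [a]) = word_value G w \<otimes>\<^bsub>G\<^esub> letter G a"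
      using word_value_append[OF G(2) w(1), of "[a]"] a G(2) letter_closed[OF G(2) a] by auto
    obtain z where z: "walk X w x z" using snoc.IH w by blast
    have zb: "z \<in> graph_ball X x r" "f z = word_value G w"
      if "walk X w x z" for z
      using snoc.IH w that by blast+
    have wc: "word_value G w \<in> carrier G" by (rule word_value_closed[OF G(2) w(1)])
    have "walk ?C (w @ [a]) \<one>\<^bsub>G\<^esub> (word_value G (w @ [a]))"
      using walk_cayley[OF G aw, of "\<one>\<^bsub>G\<^esub>"] word_value_closed[OF G(2) aw] by simp
    then have "word_value G (w @ [a]) \<in> graph_ball ?C \<one>\<^bsub>G\<^esub> r"
      using word_value_closed[OF G(2) aw] snoc.prems
      by (intro walk_in_graph_ball) (auto simp: cayley_graph_def)
    then have "word_value G (w @ [a]) \<in> f ` graph_ball X x r"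
      using bij_betw_imp_surj_on[OF bij] by simp
    then obtain y where y: "y \<in> graph_ball X x r" "f y = word_value G (w @ [a])" by auto
    have "edge_step ?C a (f z) (f y)"
      using edge_step_cayley[OF G a wc] y(2) val zb[OF z] by simp
    then have "walk X (w @ [a]) x y"
      using step[OF zb(1)[OF z] y(1), of a] z unfolding walk_append by auto
    moreover have "y' \<in> graph_ball X x r \<and> f y' = word_value G (w @ [a])"
      if y': "walk X (w @ [a]) x y'" for y'
    proof -
      obtain z' where z': "walk X w x z'" "edge_step X a z' y'" using y' by (auto simp: walk_append)
      have b: "y' \<in> graph_ball X x r"
        using walk_in_graph_ball[OF y' walk_verts[OF E y' xV]] snoc.prems by simp
      then have "edge_step ?C a (f z') (f y')" using step[OF zb(1)[OF z'(1)]] z'(2) by simp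
      then show ?thesis using b edge_step_cayley[OF G a wc] zb(2)[OF z'(1)] val by simp
    qed
    ultimately show ?case by blast
  qed
  show thesis
    using main bij by (intro that[of f]) (auto simp: bij_betw_def)
qed

text \<open>The choice of the word does not matter at vertices of large good radius; fixing one for each \<open>g\<close>
  makes \<open>right_move\<close> below a function.\<close>
definition chosen_word :: "('g, 'm) monoid_scheme \<Rightarrow> 'g set \<Rightarrow> 'g \<Rightarrow> ('g \<times> bool) list" where
  "chosen_word G S g = (SOME w. w \<in> words S \<and> word_value G w = g)"

text \<open>At vertices of large good radius this is the right translation by \<open>g\<close>.\<close>
definition right_move ::
    "('g, 'm) monoid_scheme \<Rightarrow> 'g set \<Rightarrow> ('v, 'g) lgraph \<Rightarrow> 'g \<Rightarrow> 'v \<Rightarrow> 'v" where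
  "right_move G S X g x = (SOME y. walk X (chosen_word G S g) x y)"

locale generated_group = group G for G (structure) and S +
  assumes finite_gens: "finite S" and gens: "S \<subseteq> carrier G" and generates: "generate G S = carrier G"
begin

definition len :: "'a \<Rightarrow> nat" where "len g = length (chosen_word G S g)"

lemma chosen_word:
  assumes "g \<in> carrier G"
  shows "chosen_word G S g \<in> words S" and "word_value G (chosen_word G S g) = g"
proof -
  have "\<exists>w. w \<in> words S \<and> word_value G w = g"
    using generate_word[OF gens] assms generates by blast
  then show "chosen_word G S g \<in> words S" and "word_value G (chosen_word G S g) = g"
    unfolding chosen_word_def by (metis (mono_tags, lifting) someI_ex)+
qed

context
  fixes X :: "('v, 'a) lgraph" and x :: 'v and r :: real
  assumes X: "finite_lgraph_over S X" and good: "x \<in> good_verts G S X r"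
begin

lemma good_in_verts: "x \<in> verts X"
  using good by (simp add: good_verts_def)

lemma good_walk_ex:
  assumes "w \<in> words S" "real (length w) \<le> r"
  shows "\<exists>y. walk X w x y"
  using good_vert_walks[OF is_group gens X good] assms by metis

lemma good_walk_eq_iff:
  assumes "w \<in> words S" "real (length w) \<le> r" "w' \<in> words S" "real (length w') \<le> r"
    and "walk X w x y" "walk X w' x y'"
  shows "y = y' \<longleftrightarrow> word_value G w = word_value G w'"
proof -
  obtain f where f: "inj_on f (graph_ball X x r)"
    "\<And>w y. w \<in> words S \<Longrightarrow> real (length w) \<le> r \<Longrightarrow> walk X w x y \<Longrightarrow>
      y \<in> graph_ball X x r \<and> f y = word_value G w"
    using good_vert_walks[OF is_group gens X good] by metis
  show ?thesis using f(1) f(2)[OF assms(1,2,5)] f(2)[OF assms(3,4,6)]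
      f(2)[OF assms(1,2)] inj_onD[OF f(1), of y y'] by metis
qed

lemma right_move_walk:
  assumes "g \<in> carrier G" "real (len g) \<le> r"
  shows "walk X (chosen_word G S g) x (right_move G S X g x)"
  unfolding right_move_def using good_walk_ex[OF chosen_word(1)[OF assms(1)]] assms(2)
  by (auto simp: len_def intro: someI_ex)

lemma right_move_in_ball:
  assumes "g \<in> carrier G" "real (len g) \<le> r"
  shows "right_move G S X g x \<in> graph_ball X x r"
proof -
  have "right_move G S X g x \<in> verts X"
    using walk_verts[where S = S, OF _ right_move_walk[OF assms] good_in_verts] X
    by (simp add: finite_lgraph_over_def)
  then show ?thesis
    using walk_in_graph_ball[OF right_move_walk[OF assms]] assms(2) by (simp add: len_def)
qed

lemma right_move_in_verts:
  "g \<in> carrier G \<Longrightarrow> real (len g) \<le> r \<Longrightarrow> right_move G S X g x \<in> verts X"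
  using right_move_in_ball by (simp add: graph_ball_def)

lemma right_move_eq_iff:
  assumes "g \<in> carrier G" "real (len g) \<le> r" "k \<in> carrier G" "real (len k) \<le> r"
  shows "right_move G S X g x = right_move G S X k x \<longleftrightarrow> g = k"
  using good_walk_eq_iff[OF chosen_word(1)[OF assms(1)] _ chosen_word(1)[OF assms(3)] _
      right_move_walk[OF assms(1,2)] right_move_walk[OF assms(3,4)]] assms
  by (simp add: len_def chosen_word)

lemma right_move_one:
  assumes "real (len \<one>) \<le> r"
  shows "right_move G S X \<one> x = x"
  using good_walk_eq_iff[OF chosen_word(1)[OF one_closed] _ _ _ right_move_walk[OF one_closed assms], of "[]" x] assms
  by (simp add: len_def chosen_word)

text \<open>Both sides are ends of walks from \<open>x\<close>, and the words of these walks have the same value. The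
  intermediate vertex may have a smaller good radius; the good radius of \<open>x\<close> alone is used.\<close>
lemma right_move_mult:
  assumes g: "g \<in> carrier G" and k: "k \<in> carrier G"
    and r: "real (len g + len k) \<le> r" "real (len (g \<otimes> k)) \<le> r"
  shows "right_move G S X k (right_move G S X g x) = right_move G S X (g \<otimes> k) x"
proof -
  let ?w = "chosen_word G S g" and ?w' = "chosen_word G S k"
  let ?y = "right_move G S X g x"
  have lg: "real (len g) \<le> r" using r by simp
  have ww: "?w @ ?w' \<in> words S" "real (length (?w @ ?w')) \<le> r"
    using chosen_word(1)[OF g] chosen_word(1)[OF k] r by (auto simp: len_def)
  obtain z where "walk X (?w @ ?w') x z" using good_walk_ex[OF ww] by blast
  then obtain y where y: "walk X ?w x y" "walk X ?w' y z" by (auto simp: walk_append)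
  have "y = ?y"
    using good_walk_eq_iff[OF chosen_word(1)[OF g] _ chosen_word(1)[OF g] _ y(1) right_move_walk[OF g lg]] lg
    by (simp add: len_def)
  then have "walk X ?w' ?y (right_move G S X k ?y)"
    unfolding right_move_def[of G S X k] using y(2) by (auto intro: someI)
  then have "walk X (?w @ ?w') x (right_move G S X k ?y)"
    using right_move_walk[OF g lg] by (auto simp: walk_append)
  then show ?thesis
    using good_walk_eq_iff[OF ww chosen_word(1)[of "g \<otimes> k"] _ _ right_move_walk[of "g \<otimes> k"]] r g k
    by (simp add: len_def chosen_word word_value_append[OF gens])
qed

end

end

section \<open>The random map seen from a random vertex\<close>

text \<open>The map \<open>f\<close> with \<open>g\<close> as the new base point, multiplied by a constant so that its value there is \<open>1\<close>.\<close>
definition increments ::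
    "('g, 'm) monoid_scheme \<Rightarrow> ('h, 'k) monoid_scheme \<Rightarrow> 'g \<Rightarrow> ('g \<Rightarrow> 'h) \<Rightarrow> 'g \<Rightarrow> 'h" where
  "increments G H g f = (\<lambda>k\<in>carrier G. inv\<^bsub>H\<^esub> (f g) \<otimes>\<^bsub>H\<^esub> f (g \<otimes>\<^bsub>G\<^esub> k))"

abbreviation map_space :: "('g, 'm) monoid_scheme \<Rightarrow> ('h, 'k) monoid_scheme \<Rightarrow> ('g \<Rightarrow> 'h) measure" where
  "map_space G H \<equiv> PiM (carrier G) (\<lambda>_. count_space (carrier H))"

lemma space_map_space: "space (map_space G H) = carrier G \<rightarrow>\<^sub>E carrier H"
  by (simp add: space_PiM)

lemma measurable_increments:
  assumes "group G" "group H" and H: "countable (carrier H)" and g: "g \<in> carrier G"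
  shows "increments G H g \<in> map_space G H \<rightarrow>\<^sub>M map_space G H"
  unfolding increments_def
proof (rule measurable_restrict)
  interpret G: group G by fact
  interpret H: group H by fact
  fix k assume k: "k \<in> carrier G"
  have coord: "(\<lambda>f. f k') \<in> map_space G H \<rightarrow>\<^sub>M count_space (carrier H)" if "k' \<in> carrier G" for k'
    by (rule measurable_component_singleton[OF that])
  have "(\<lambda>(a, b). inv\<^bsub>H\<^esub> a \<otimes>\<^bsub>H\<^esub> b) \<in> count_space (carrier H) \<Otimes>\<^sub>M count_space (carrier H)
      \<rightarrow>\<^sub>M count_space (carrier H)"
    by (rule measurable_pair_measure_countable1[OF H]) auto
  from measurable_compose[OF measurable_Pair[OF coord coord] this, of g "g \<otimes>\<^bsub>G\<^esub> k"]
  show "(\<lambda>f. inv\<^bsub>H\<^esub> (f g) \<otimes>\<^bsub>H\<^esub> f (g \<otimes>\<^bsub>G\<^esub> k)) \<in> map_space G H \<rightarrow>\<^sub>M count_space (carrier H)"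
    using g k by simp
qed

lemma word_dist_le_word_diam:
  assumes "finite A" "x \<in> A" "y \<in> A"
  shows "real (word_dist H T x y) \<le> word_diam H T A"
proof -
  have "(case (x, y) of (x, y) \<Rightarrow> real (word_dist H T x y)) \<le> word_diam H T A"
    unfolding word_diam_def using assms
    by (intro cSUP_upper bdd_above_finite finite_imageI finite_cartesian_product) auto
  then show ?thesis by simp
qed

locale lipschitz_injections =
  G: generated_group G S\<^sub>G + H: generated_group H S\<^sub>H
  for G :: "('g, 'm) monoid_scheme" and S\<^sub>G and H :: "('h, 'k) monoid_scheme" and S\<^sub>H +
  fixes \<G> :: "nat \<Rightarrow> ('v, 'g) lgraph" and U :: "nat filter" and u :: "nat \<Rightarrow> 'v \<Rightarrow> 'h"
  assumes sofic: "sofic_approximation G S\<^sub>G \<G>"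
    and nonprincipal: "nonprincipal_ultrafilter U"
    and u_in: "u n ` verts (\<G> n) \<subseteq> carrier H"
    and u_inj: "inj_on (u n) (verts (\<G> n))"
    and lipschitz: "statistically_lipschitz U \<G> H S\<^sub>H u"
begin

lemma graph: "finite_lgraph_over S\<^sub>G (\<G> n)"
  using sofic by (simp add: sofic_approximation_def)

lemma good_ratio_tendsto:
  assumes "r > 0"
  shows "((\<lambda>n. real (card (good_verts G S\<^sub>G (\<G> n) r)) / real (card (verts (\<G> n)))) \<longlongrightarrow> 1) U"
proof -
  have "(\<lambda>n. real (card (good_verts G S\<^sub>G (\<G> n) r)) / real (card (verts (\<G> n)))) \<longlonglongrightarrow> 1"
    using sofic assms by (simp add: sofic_approximation_def)
  then show ?thesis by (rule tendsto_mono[OF nonprincipal_ultrafilter_le_sequentially[OF nonprincipal]])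
qed

sublocale ultralimit U "\<lambda>n. verts (\<G> n)"
proof
  show "nonprincipal_ultrafilter U" by (rule nonprincipal)
  show "finite (verts (\<G> n))" for n using graph by (simp add: finite_lgraph_over_def)
  have "eventually (\<lambda>n. real (card (good_verts G S\<^sub>G (\<G> n) 1)) / real (card (verts (\<G> n))) > 0) U"
    using good_ratio_tendsto[of 1] by (rule order_tendstoD) auto
  then show "eventually (\<lambda>n. verts (\<G> n) \<noteq> {}) U"
    by (rule eventually_mono) auto
qed

lemma pr_good:
  assumes "r > 0"
  shows "pr (\<lambda>n v. v \<in> good_verts G S\<^sub>G (\<G> n) r) = 1"
proof (rule pr_eqI)
  have "freq (\<lambda>n v. v \<in> good_verts G S\<^sub>G (\<G> n) r)
      = (\<lambda>n. real (card (good_verts G S\<^sub>G (\<G> n) r)) / real (card (verts (\<G> n))))"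
  proof
    fix n
    have "{v \<in> verts (\<G> n). v \<in> good_verts G S\<^sub>G (\<G> n) r} = good_verts G S\<^sub>G (\<G> n) r"
      by (auto simp: good_verts_def)
    then show "freq (\<lambda>n v. v \<in> good_verts G S\<^sub>G (\<G> n) r) n
        = real (card (good_verts G S\<^sub>G (\<G> n) r)) / real (card (verts (\<G> n)))"
      by (simp add: freq_def)
  qed
  then show "(freq (\<lambda>n v. v \<in> good_verts G S\<^sub>G (\<G> n) r) \<longlongrightarrow> 1) U"
    using good_ratio_tendsto[OF assms] by simp
qed

lemma pr_small_diam:
  assumes "r > 0" and "e > 0"
  shows "\<exists>C. 1 - e < pr (\<lambda>n v. word_diam H S\<^sub>H (u n ` graph_ball (\<G> n) v r) < C)"
proof -
  let ?Q = "\<lambda>C n v. word_diam H S\<^sub>H (u n ` graph_ball (\<G> n) v r) \<ge> C"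
  have *: "Lim U (\<lambda>n. measure (uniform_count_measure (verts (\<G> n))) {v \<in> verts (\<G> n). ?Q C n v})
      = pr (?Q C)" for C
  proof -
    have "freq (?Q C)
        = (\<lambda>n. measure (uniform_count_measure (verts (\<G> n))) {v \<in> verts (\<G> n). ?Q C n v})"
      by (rule ext) (simp add: freq_def measure_uniform_count_measure[OF finite_V])
    then show ?thesis by (simp add: pr_def)
  qed
  have "((\<lambda>C. pr (?Q C)) \<longlongrightarrow> 0) (at_top :: real filter)"
    using lipschitz[unfolded statistically_lipschitz_def, rule_format, OF \<open>r > 0\<close>]
    unfolding * .
  then have "eventually (\<lambda>C. pr (?Q C) < e) (at_top :: real filter)"
    using \<open>e > 0\<close> by (rule order_tendstoD)
  then obtain C where "pr (?Q C) < e" by (auto simp: eventually_at_top_linorder)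
  then have "1 - e < pr (\<lambda>n v. \<not> ?Q C n v)" by (simp add: pr_not)
  then show ?thesis by (auto simp: not_le)
qed

abbreviation move :: "nat \<Rightarrow> 'g \<Rightarrow> 'v \<Rightarrow> 'v" where
  "move n \<equiv> right_move G S\<^sub>G (\<G> n)"

text \<open>The default value \<open>1\<close>, chosen to lie in \<open>H\<close>, is for vertices without the required walk, where the move
  may leave the graph. In the limit such vertices have probability zero.\<close>
definition rel_map :: "nat \<Rightarrow> 'v \<Rightarrow> 'g \<Rightarrow> 'h" where
  "rel_map n v g =
     (if move n g v \<in> verts (\<G> n) then inv\<^bsub>H\<^esub> (u n v) \<otimes>\<^bsub>H\<^esub> u n (move n g v) else \<one>\<^bsub>H\<^esub>)"

lemma u_closed: "v \<in> verts (\<G> n) \<Longrightarrow> u n v \<in> carrier H"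
  using u_in by blast

lemma rel_map_closed: "v \<in> verts (\<G> n) \<Longrightarrow> rel_map n v g \<in> carrier H"
  by (simp add: rel_map_def u_closed)

lemma rel_map_good:
  assumes "v \<in> good_verts G S\<^sub>G (\<G> n) r" "g \<in> carrier G" "real (G.len g) \<le> r"
  shows "rel_map n v g = inv\<^bsub>H\<^esub> (u n v) \<otimes>\<^bsub>H\<^esub> u n (move n g v)"
  using G.right_move_in_verts[OF graph assms] by (simp add: rel_map_def)

text \<open>If the image of the ball around \<open>v\<close> has diameter less than \<open>C\<close>, then the value at \<open>g\<close> has word length
  less than \<open>C\<close>, and there are finitely many such elements of \<open>H\<close>.\<close>
lemma rel_map_tight:
  assumes g: "g \<in> carrier G" and e: "e > 0"
  shows "\<exists>F. finite F \<and> 1 - e < pr (\<lambda>n v. rel_map n v g \<in> F)"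
proof -
  \<comment> \<open>the summand one makes the radius positive also for \<open>g = 1\<close>\<close>
  define r where "r = real (G.len g) + 1"
  have r: "r > 0" by (simp add: r_def)
  obtain C where C: "1 - e < pr (\<lambda>n v. word_diam H S\<^sub>H (u n ` graph_ball (\<G> n) v r) < C)"
    using pr_small_diam[OF r e] by blast
  let ?F = "{h \<in> carrier H. word_length H S\<^sub>H h \<le> nat \<lceil>C\<rceil>}"
  have "pr (\<lambda>n v. word_diam H S\<^sub>H (u n ` graph_ball (\<G> n) v r) < C)
      = pr (\<lambda>n v. v \<in> good_verts G S\<^sub>G (\<G> n) r \<and> word_diam H S\<^sub>H (u n ` graph_ball (\<G> n) v r) < C)"
    by (rule pr_cong_almost[OF pr_good[OF r]]) auto
  also have "\<dots> \<le> pr (\<lambda>n v. rel_map n v g \<in> ?F)"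
  proof (rule pr_mono, elim conjE)
    fix n v assume v: "v \<in> verts (\<G> n)" and good: "v \<in> good_verts G S\<^sub>G (\<G> n) r"
      and diam: "word_diam H S\<^sub>H (u n ` graph_ball (\<G> n) v r) < C"
    have "v \<in> graph_ball (\<G> n) v r"
      using walk_in_graph_ball[of "\<G> n" "[]" v v r] v r by simp
    moreover have "move n g v \<in> graph_ball (\<G> n) v r"
      using G.right_move_in_ball[OF graph good g] by (simp add: r_def)
    moreover have "finite (graph_ball (\<G> n) v r)"
      using finite_V by (simp add: graph_ball_def)
    ultimately have "real (word_dist H S\<^sub>H (u n v) (u n (move n g v))) < C"
      using word_dist_le_word_diam[of "u n ` graph_ball (\<G> n) v r" "u n v" "u n (move n g v)" H S\<^sub>H]
        diam by simp
    then have "real (word_length H S\<^sub>H (rel_map n v g)) < C"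
      using rel_map_good[OF good g] by (simp add: word_dist_def r_def)
    then have "word_length H S\<^sub>H (rel_map n v g) \<le> nat \<lceil>C\<rceil>" by linarith
    then show "rel_map n v g \<in> ?F" using rel_map_closed[OF v] by simp
  qed
  finally have "1 - e < pr (\<lambda>n v. rel_map n v g \<in> ?F)" using C by simp
  moreover have "finite ?F"
    by (rule H.finite_word_length_le[OF H.finite_gens H.gens H.generates])
  ultimately show ?thesis by blast
qed

text \<open>The move by \<open>g\<close> is undone by the move by the inverse of \<open>g\<close>, so it is injective on good vertices.\<close>
lemma pr_move:
  assumes g: "g \<in> carrier G"
  shows "pr (\<lambda>n v. Q n (move n g v)) = pr Q"
proof -
  \<comment> \<open>far enough for the move by \<open>g\<close>, for the way back and for their product, which is \<open>1\<close>\<close>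
  define r where "r = real (G.len g + G.len (inv\<^bsub>G\<^esub> g) + G.len \<one>\<^bsub>G\<^esub> + 1)"
  have r: "r > 0" by (simp add: r_def)
  show ?thesis
  proof (rule pr_shift[OF pr_good[OF r]])
    fix n v assume v: "v \<in> good_verts G S\<^sub>G (\<G> n) r"
    show "move n g v \<in> verts (\<G> n)"
      by (rule G.right_move_in_verts[OF graph v g]) (simp add: r_def)
  next
    fix n
    have "move n (inv\<^bsub>G\<^esub> g) (move n g v) = v" if v: "v \<in> good_verts G S\<^sub>G (\<G> n) r" for v
    proof -
      have "move n (inv\<^bsub>G\<^esub> g) (move n g v) = move n (g \<otimes>\<^bsub>G\<^esub> inv\<^bsub>G\<^esub> g) v"
        using g by (intro G.right_move_mult[OF graph v]) (auto simp: r_def)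
      also have "\<dots> = v" using g G.right_move_one[OF graph v] by (simp add: r_def)
      finally show ?thesis .
    qed
    then show "inj_on (move n g) {v \<in> verts (\<G> n). v \<in> good_verts G S\<^sub>G (\<G> n) r}"
      by (intro inj_on_inverseI[where g = "move n (inv\<^bsub>G\<^esub> g)"]) auto
  qed
qed

lemma rel_map_distinct:
  assumes g: "g \<in> carrier G" and k: "k \<in> carrier G" and "g \<noteq> k"
  shows "pr (\<lambda>n v. rel_map n v g \<noteq> rel_map n v k) = 1"
proof -
  define r where "r = real (G.len g + G.len k + 1)"
  have r: "r > 0" "real (G.len g) \<le> r" "real (G.len k) \<le> r" by (simp_all add: r_def)
  have "pr (\<lambda>n v. rel_map n v g \<noteq> rel_map n v k) = pr (\<lambda>n v. True)"
  proof (rule pr_cong_almost[OF pr_good[OF r(1)]])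
    fix n v assume v: "v \<in> verts (\<G> n)" "v \<in> good_verts G S\<^sub>G (\<G> n) r"
    have in_verts: "move n g v \<in> verts (\<G> n)" "move n k v \<in> verts (\<G> n)"
      using G.right_move_in_verts[OF graph v(2)] g k r by auto
    have "move n g v \<noteq> move n k v"
      using G.right_move_eq_iff[OF graph v(2) g r(2) k r(3)] \<open>g \<noteq> k\<close> by simp
    then have "u n (move n g v) \<noteq> u n (move n k v)"
      using in_verts u_inj by (auto dest: inj_onD)
    then show "rel_map n v g \<noteq> rel_map n v k \<longleftrightarrow> True"
      using rel_map_good[OF v(2) g r(2)] rel_map_good[OF v(2) k r(3)] in_verts v(1)
      by (simp add: u_closed)
  qed
  then show ?thesis by (simp add: pr_True)
qed

text \<open>In the increments the value of \<open>u\<close> at \<open>v\<close> cancels, and the move by \<open>g\<close> followed by the one by \<open>j\<close> is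
  the move by their product. Thus the map seen from the moved vertex consists of increments of the
  map seen from \<open>v\<close>.\<close>
lemma rel_map_move:
  assumes g: "g \<in> carrier G" and J: "finite J" "J \<subseteq> carrier G"
  shows "\<exists>r > 0. \<forall>n v. v \<in> good_verts G S\<^sub>G (\<G> n) r \<longrightarrow>
    (\<forall>j\<in>J. inv\<^bsub>H\<^esub> (rel_map n v g) \<otimes>\<^bsub>H\<^esub> rel_map n v (g \<otimes>\<^bsub>G\<^esub> j) = rel_map n (move n g v) j)"
proof (intro exI conjI allI impI ballI)
  define r where "r = real (G.len g + (\<Sum>j\<in>J. G.len j + G.len (g \<otimes>\<^bsub>G\<^esub> j)) + 1)"
  show "r > 0" unfolding r_def of_nat_0_less_iff by simp
  fix n v j assume v: "v \<in> good_verts G S\<^sub>G (\<G> n) r" and j: "j \<in> J"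
  have "G.len j + G.len (g \<otimes>\<^bsub>G\<^esub> j) \<le> (\<Sum>j\<in>J. G.len j + G.len (g \<otimes>\<^bsub>G\<^esub> j))"
    using j J(1) by (intro member_le_sum) auto
  then have r: "real (G.len g + G.len j) \<le> r" "real (G.len g) \<le> r" "real (G.len (g \<otimes>\<^bsub>G\<^esub> j)) \<le> r"
    by (unfold r_def of_nat_le_iff) linarith+
  have jG: "j \<in> carrier G" and gj: "g \<otimes>\<^bsub>G\<^esub> j \<in> carrier G" using j J(2) g by auto
  have mult: "move n j (move n g v) = move n (g \<otimes>\<^bsub>G\<^esub> j) v"
    by (rule G.right_move_mult[OF graph v g jG r(1,3)])
  have V: "v \<in> verts (\<G> n)" "move n g v \<in> verts (\<G> n)" "move n (g \<otimes>\<^bsub>G\<^esub> j) v \<in> verts (\<G> n)"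
    using G.good_in_verts[OF graph v] G.right_move_in_verts[OF graph v g r(2)]
      G.right_move_in_verts[OF graph v gj r(3)] by auto
  then have c: "u n v \<in> carrier H" "u n (move n g v) \<in> carrier H" "u n (move n (g \<otimes>\<^bsub>G\<^esub> j) v) \<in> carrier H"
    by (simp_all add: u_closed)
  have "rel_map n (move n g v) j = inv\<^bsub>H\<^esub> (u n (move n g v)) \<otimes>\<^bsub>H\<^esub> u n (move n (g \<otimes>\<^bsub>G\<^esub> j) v)"
    using V by (simp add: rel_map_def mult)
  moreover have "inv\<^bsub>H\<^esub> (rel_map n v g) \<otimes>\<^bsub>H\<^esub> rel_map n v (g \<otimes>\<^bsub>G\<^esub> j)
      = inv\<^bsub>H\<^esub> (u n (move n g v)) \<otimes>\<^bsub>H\<^esub> u n (move n (g \<otimes>\<^bsub>G\<^esub> j) v)"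
    using c rel_map_good[OF v g r(2)] rel_map_good[OF v gj r(3)]
    by (simp add: H.inv_mult_group H.m_assoc[symmetric])
      (simp add: H.m_assoc)
  ultimately show "inv\<^bsub>H\<^esub> (rel_map n v g) \<otimes>\<^bsub>H\<^esub> rel_map n v (g \<otimes>\<^bsub>G\<^esub> j) = rel_map n (move n g v) j"
    by simp
qed

text \<open>The law of the increments at \<open>g\<close> is determined by its values on finitely many points. There it is the
  limit law of the map seen from the vertex moved by \<open>g\<close>, and that vertex is as random as the original
  one.\<close>
theorem ex_stationary_law:
  shows "\<exists>\<nu>. prob_space \<nu> \<and> sets \<nu> = sets (map_space G H) \<and>
    (AE f in \<nu>. inj_on f (carrier G)) \<and>
    (\<forall>g \<in> carrier G. distr \<nu> (map_space G H) (increments G H g) = \<nu>)"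
proof -
  have countG: "countable (carrier G)" and countH: "countable (carrier H)"
    using G.countable_carrier[OF G.finite_gens G.gens G.generates]
      H.countable_carrier[OF H.finite_gens H.gens H.generates] by auto
  have neH: "carrier H \<noteq> {}" using H.one_closed by blast
  have "\<exists>\<nu>. prob_space \<nu> \<and> sets \<nu> = sets (map_space G H) \<and>
    (\<forall>J A. finite J \<longrightarrow> J \<subseteq> carrier G \<longrightarrow>
      measure \<nu> {f \<in> space \<nu>. restrict f J \<in> A} = pr (\<lambda>n v. restrict (rel_map n v) J \<in> A))"
    by (rule ex_limit_process[OF countH neH]) (auto intro: rel_map_closed rel_map_tight)
  then obtain \<nu> where prob: "prob_space \<nu>" and sets: "sets \<nu> = sets (map_space G H)"
    and law': "\<forall>J A. finite J \<longrightarrow> J \<subseteq> carrier G \<longrightarrow>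
      measure \<nu> {f \<in> space \<nu>. restrict f J \<in> A} = pr (\<lambda>n v. restrict (rel_map n v) J \<in> A)"
    by (elim exE conjE)
  note law = law'[rule_format]
  interpret prob_space \<nu> by (rule prob)
  have meas: "{f \<in> space \<nu>. restrict f J \<in> A} \<in> sets \<nu>" if "finite J" "J \<subseteq> carrier G" for J A
    using measurable_restrict_vimage[OF that countH, of A] sets sets_eq_imp_space_eq[OF sets] by simp
  have AE_I: "AE f in \<nu>. restrict f J \<in> A"
    if "finite J" "J \<subseteq> carrier G" "pr (\<lambda>n v. restrict (rel_map n v) J \<in> A) = 1" for J A
    using AE_in_set_eq_1[OF meas[OF that(1,2), of A]] law[OF that(1,2), of A] that(3) by auto
  have "AE f in \<nu>. f g \<noteq> f k" if "g \<in> carrier G" "k \<in> carrier G" "g \<noteq> k" for g k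
    using AE_I[of "{g, k}" "{f. f g \<noteq> f k}"] rel_map_distinct that by simp
  then have "AE f in \<nu>. \<forall>p \<in> {(g, k). g \<in> carrier G \<and> k \<in> carrier G \<and> g \<noteq> k}. f (fst p) \<noteq> f (snd p)"
    using countG by (intro AE_ball_countable'[rotated])
      (auto intro: countable_subset[OF _ countable_SIGMA[of "carrier G" "\<lambda>_. carrier G"]])
  then have inj: "AE f in \<nu>. inj_on f (carrier G)"
    by (rule AE_mp) (auto simp: inj_on_def)
  have "distr \<nu> (map_space G H) (increments G H g) = \<nu>" if g: "g \<in> carrier G" for g
  proof (rule measure_eqI_PiM_infinite[where I = "carrier G" and M = "\<lambda>_. count_space (carrier H)"])
    have mI: "increments G H g \<in> \<nu> \<rightarrow>\<^sub>M map_space G H"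
      using measurable_increments[OF G.is_group H.is_group countH g]
      by (simp add: measurable_cong_sets[OF sets refl])
    interpret D: prob_space "distr \<nu> (map_space G H) (increments G H g)"
      by (rule prob_space_distr[OF mI])
    show "finite_measure (distr \<nu> (map_space G H) (increments G H g))" by unfold_locales
    fix J and A :: "'g \<Rightarrow> 'h set"
    assume J: "finite J" "J \<subseteq> carrier G" and A: "\<And>i. i \<in> J \<Longrightarrow> A i \<in> sets (count_space (carrier H))"
    let ?E = "prod_emb (carrier G) (\<lambda>_. count_space (carrier H)) J (Pi\<^sub>E J A)"
    let ?J = "insert g ((\<lambda>j. g \<otimes>\<^bsub>G\<^esub> j) ` J)"
    have J': "finite ?J" "?J \<subseteq> carrier G" using J g by auto
    have E: "?E = {f \<in> space \<nu>. restrict f J \<in> Pi\<^sub>E J A}"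
      using sets_eq_imp_space_eq[OF sets] by (auto simp: prod_emb_def space_PiM)
    have E_sets: "?E \<in> sets (map_space G H)" using J A by (intro sets_PiM_I) auto
    let ?B = "{f. \<forall>j\<in>J. inv\<^bsub>H\<^esub> (f g) \<otimes>\<^bsub>H\<^esub> f (g \<otimes>\<^bsub>G\<^esub> j) \<in> A j}"
    have "increments G H g -` ?E \<inter> space \<nu> = {f \<in> space \<nu>. restrict f ?J \<in> ?B}"
    proof -
      have "increments G H g f \<in> ?E \<longleftrightarrow> restrict f ?J \<in> ?B" if f: "f \<in> space \<nu>" for f
      proof -
        have "increments G H g f \<in> space \<nu>"
          using measurable_space[OF mI f] sets_eq_imp_space_eq[OF sets] by simp
        then have "increments G H g f \<in> ?E \<longleftrightarrow> (\<forall>j\<in>J. increments G H g f j \<in> A j)"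
          unfolding E by (auto simp: PiE_iff)
        also have "\<dots> \<longleftrightarrow> restrict f ?J \<in> ?B" using J(2) by (auto simp: increments_def)
        finally show ?thesis .
      qed
      then show ?thesis by blast
    qed
    then have "measure (distr \<nu> (map_space G H) (increments G H g)) ?E
        = measure \<nu> {f \<in> space \<nu>. restrict f ?J \<in> ?B}"
      by (simp add: measure_distr[OF mI E_sets])
    also have "\<dots> = pr (\<lambda>n v. restrict (rel_map n v) ?J \<in> ?B)" by (rule law[OF J'])
    also have "\<dots> = pr (\<lambda>n v. \<forall>j\<in>J. inv\<^bsub>H\<^esub> (rel_map n v g) \<otimes>\<^bsub>H\<^esub> rel_map n v (g \<otimes>\<^bsub>G\<^esub> j) \<in> A j)"
      by (rule pr_cong) auto
    also have "\<dots> = pr (\<lambda>n v. \<forall>j\<in>J. rel_map n (move n g v) j \<in> A j)"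
    proof -
      obtain r where r: "r > 0" "\<And>n v j. v \<in> good_verts G S\<^sub>G (\<G> n) r \<Longrightarrow> j \<in> J \<Longrightarrow>
        inv\<^bsub>H\<^esub> (rel_map n v g) \<otimes>\<^bsub>H\<^esub> rel_map n v (g \<otimes>\<^bsub>G\<^esub> j) = rel_map n (move n g v) j"
        using rel_map_move[OF g J] by blast
      show ?thesis by (rule pr_cong_almost[OF pr_good[OF r(1)]]) (simp add: r(2))
    qed
    also have "\<dots> = pr (\<lambda>n v. \<forall>j\<in>J. rel_map n v j \<in> A j)"
      by (rule pr_move[OF g, of "\<lambda>n v. \<forall>j\<in>J. rel_map n v j \<in> A j"])
    also have "\<dots> = pr (\<lambda>n v. restrict (rel_map n v) J \<in> Pi\<^sub>E J A)"
      by (rule pr_cong) (auto simp: PiE_iff)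
    also have "\<dots> = measure \<nu> ?E" unfolding E by (rule law[OF J, symmetric])
    finally show "emeasure (distr \<nu> (map_space G H) (increments G H g)) ?E = emeasure \<nu> ?E"
      by (simp add: D.emeasure_eq_measure emeasure_eq_measure)
  qed (use sets in auto)
  then show ?thesis using prob sets inj by blast
qed

end

section \<open>The coupling on the space of injective maps\<close>

lemma group_actionI:
  assumes "group G"
    and closed: "\<And>g x. g \<in> carrier G \<Longrightarrow> x \<in> E \<Longrightarrow> a g x \<in> E"
    and one: "\<And>x. x \<in> E \<Longrightarrow> a \<one>\<^bsub>G\<^esub> x = x"
    and mult: "\<And>g h x. g \<in> carrier G \<Longrightarrow> h \<in> carrier G \<Longrightarrow> x \<in> E \<Longrightarrow> a (g \<otimes>\<^bsub>G\<^esub> h) x = a g (a h x)"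
  shows "group_action G E (\<lambda>g. restrict (a g) E)"
proof -
  interpret group G by fact
  have inverse: "a g (a (inv\<^bsub>G\<^esub> g) x) = x" "a (inv\<^bsub>G\<^esub> g) (a g x) = x" if "g \<in> carrier G" "x \<in> E" for g x
    using that one mult[of g "inv\<^bsub>G\<^esub> g" x] mult[of "inv\<^bsub>G\<^esub> g" g x] by simp_all
  have Bij: "restrict (a g) E \<in> Bij E" if g: "g \<in> carrier G" for g
  proof -
    have "bij_betw (a g) E E"
      using g by (intro bij_betwI[where g = "a (inv\<^bsub>G\<^esub> g)"]) (auto simp: closed inverse)
    then show ?thesis by (simp add: Bij_def cong: bij_betw_cong)
  qed
  have "restrict (a (g \<otimes>\<^bsub>G\<^esub> h)) E = restrict (a g) E \<otimes>\<^bsub>BijGroup E\<^esub> restrict (a h) E"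
    if "g \<in> carrier G" "h \<in> carrier G" for g h
    using that Bij by (auto simp: BijGroup_def compose_def fun_eq_iff mult closed)
  then have "(\<lambda>g. restrict (a g) E) \<in> hom G (BijGroup E)"
    using Bij by (intro homI) (simp_all add: BijGroup_def)
  then show ?thesis
    unfolding group_action_def
    by (intro group_hom.intro group_hom_axioms.intro group_BijGroup) (use assms(1) in auto)
qed

lemma emeasure_count_space_bij_betw:
  assumes "bij_betw p X Y" "X \<subseteq> A" "Y \<subseteq> A"
  shows "emeasure (count_space A) X = emeasure (count_space A) Y"
  using assms bij_betw_finite[OF assms(1)] bij_betw_same_card[OF assms(1)]
  by (simp add: emeasure_count_space)

locale stationary_injection =
  G: group G + H: group H for G :: "('g, 'm) monoid_scheme" and H :: "('h, 'k) monoid_scheme" +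
  fixes \<nu> :: "('g \<Rightarrow> 'h) measure"
  assumes countable_G: "countable (carrier G)" and countable_H: "countable (carrier H)"
    and prob_\<nu>: "prob_space \<nu>" and sets_\<nu>: "sets \<nu> = sets (map_space G H)"
    and injective: "AE f in \<nu>. inj_on f (carrier G)"
    and stationary: "g \<in> carrier G \<Longrightarrow> distr \<nu> (map_space G H) (increments G H g) = \<nu>"
begin

definition arg_shift :: "'g \<Rightarrow> ('g \<Rightarrow> 'h) \<Rightarrow> 'g \<Rightarrow> 'h" where
  "arg_shift g f = (\<lambda>k\<in>carrier G. f (inv\<^bsub>G\<^esub> g \<otimes>\<^bsub>G\<^esub> k))"

definition val_shift :: "'h \<Rightarrow> ('g \<Rightarrow> 'h) \<Rightarrow> 'g \<Rightarrow> 'h" where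
  "val_shift h f = (\<lambda>k\<in>carrier G. h \<otimes>\<^bsub>H\<^esub> f k)"

definition \<Omega> :: "('g \<Rightarrow> 'h) set" where
  "\<Omega> = {f \<in> carrier G \<rightarrow>\<^sub>E carrier H. inj_on f (carrier G)}"

definition X\<^sub>G :: "('g \<Rightarrow> 'h) set" where
  "X\<^sub>G = {f \<in> \<Omega>. \<forall>k\<in>carrier G. to_nat_on (carrier H) (f \<one>\<^bsub>G\<^esub>) \<le> to_nat_on (carrier H) (f k)}"

definition X\<^sub>H :: "('g \<Rightarrow> 'h) set" where
  "X\<^sub>H = {f \<in> \<Omega>. f \<one>\<^bsub>G\<^esub> = \<one>\<^bsub>H\<^esub>}"

definition \<mu> :: "('g \<Rightarrow> 'h) measure" where
  "\<mu> = distr (count_space (carrier H) \<Otimes>\<^sub>M \<nu>) (map_space G H) (\<lambda>(h, f). val_shift h f)"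

definition coupling :: "('g \<Rightarrow> 'h) measure" where
  "coupling = restrict_space \<mu> \<Omega>"

lemma space_\<nu>: "space \<nu> = carrier G \<rightarrow>\<^sub>E carrier H"
  using sets_eq_imp_space_eq[OF sets_\<nu>] by (simp add: space_map_space)

lemma space_\<mu>: "space \<mu> = carrier G \<rightarrow>\<^sub>E carrier H"
  by (simp add: \<mu>_def space_map_space)

lemma sets_\<mu>: "sets \<mu> = sets (map_space G H)"
  by (simp add: \<mu>_def)

lemma maps_closed: "f \<in> carrier G \<rightarrow>\<^sub>E carrier H \<Longrightarrow> k \<in> carrier G \<Longrightarrow> f k \<in> carrier H"
  by (rule PiE_mem)

lemma arg_shift_closed: "g \<in> carrier G \<Longrightarrow> f \<in> carrier G \<rightarrow>\<^sub>E carrier H \<Longrightarrow> arg_shift g f \<in> carrier G \<rightarrow>\<^sub>E carrier H"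
  by (auto simp: arg_shift_def)

lemma val_shift_closed: "h \<in> carrier H \<Longrightarrow> f \<in> carrier G \<rightarrow>\<^sub>E carrier H \<Longrightarrow> val_shift h f \<in> carrier G \<rightarrow>\<^sub>E carrier H"
  by (auto simp: val_shift_def)

lemma arg_shift_one: "f \<in> carrier G \<rightarrow>\<^sub>E carrier H \<Longrightarrow> arg_shift \<one>\<^bsub>G\<^esub> f = f"
  by (auto simp: arg_shift_def fun_eq_iff PiE_iff extensional_def)

lemma val_shift_one: "f \<in> carrier G \<rightarrow>\<^sub>E carrier H \<Longrightarrow> val_shift \<one>\<^bsub>H\<^esub> f = f"
  by (auto simp: val_shift_def fun_eq_iff PiE_iff extensional_def)

lemma arg_shift_mult:
  "g \<in> carrier G \<Longrightarrow> g' \<in> carrier G \<Longrightarrow> arg_shift (g \<otimes>\<^bsub>G\<^esub> g') f = arg_shift g (arg_shift g' f)"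
  by (auto simp: arg_shift_def fun_eq_iff G.inv_mult_group G.m_assoc)

lemma val_shift_mult:
  "h \<in> carrier H \<Longrightarrow> h' \<in> carrier H \<Longrightarrow> f \<in> carrier G \<rightarrow>\<^sub>E carrier H \<Longrightarrow>
    val_shift (h \<otimes>\<^bsub>H\<^esub> h') f = val_shift h (val_shift h' f)"
  by (auto simp: val_shift_def fun_eq_iff H.m_assoc maps_closed)

lemma arg_shift_val_shift: "g \<in> carrier G \<Longrightarrow> arg_shift g (val_shift h f) = val_shift h (arg_shift g f)"
  by (auto simp: arg_shift_def val_shift_def fun_eq_iff)

lemma measurable_arg_shift:
  assumes "g \<in> carrier G"
  shows "arg_shift g \<in> map_space G H \<rightarrow>\<^sub>M map_space G H"
  unfolding arg_shift_def using assms
  by (intro measurable_restrict measurable_component_singleton) auto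

lemma measurable_val_shift:
  assumes "h \<in> carrier H"
  shows "val_shift h \<in> map_space G H \<rightarrow>\<^sub>M map_space G H"
  unfolding val_shift_def
proof (rule measurable_restrict)
  fix k assume "k \<in> carrier G"
  moreover have "(\<lambda>x. h \<otimes>\<^bsub>H\<^esub> x) \<in> count_space (carrier H) \<rightarrow>\<^sub>M count_space (carrier H)"
    using assms by auto
  ultimately show "(\<lambda>f. h \<otimes>\<^bsub>H\<^esub> f k) \<in> map_space G H \<rightarrow>\<^sub>M count_space (carrier H)"
    by (intro measurable_compose[OF measurable_component_singleton])
qed

lemma measurable_val_shift_pair:
  "(\<lambda>(h, f). val_shift h f) \<in> count_space (carrier H) \<Otimes>\<^sub>M \<nu> \<rightarrow>\<^sub>M map_space G H"
  by (rule measurable_pair_measure_countable1[OF countable_H])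
    (simp add: measurable_val_shift measurable_cong_sets[OF sets_\<nu> refl])

text \<open>The mass that \<open>A\<close> has in the orbit of \<open>f\<close>, if each \<open>h\<close> contributes one. Integrating this over
  \<open>f\<close> gives \<open>\<mu>\<close>.\<close>
definition hits :: "('g \<Rightarrow> 'h) set \<Rightarrow> ('g \<Rightarrow> 'h) \<Rightarrow> ennreal" where
  "hits A f = emeasure (count_space (carrier H)) {h \<in> carrier H. val_shift h f \<in> A}"

lemma pair_sigma_finite_\<nu>: "pair_sigma_finite (count_space (carrier H)) \<nu>"
  using prob_\<nu>
  by (intro pair_sigma_finite.intro sigma_finite_measure_count_space_countable countable_H
      prob_space_imp_sigma_finite)

lemma hits_section:
  assumes "A \<in> sets (map_space G H)"
  defines "X \<equiv> (\<lambda>(h, f). val_shift h f) -` A \<inter> space (count_space (carrier H) \<Otimes>\<^sub>M \<nu>)"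
  shows "X \<in> sets (count_space (carrier H) \<Otimes>\<^sub>M \<nu>)"
    and "f \<in> space \<nu> \<Longrightarrow> emeasure (count_space (carrier H)) ((\<lambda>h. (h, f)) -` X) = hits A f"
proof -
  show "X \<in> sets (count_space (carrier H) \<Otimes>\<^sub>M \<nu>)"
    unfolding X_def by (rule measurable_sets[OF measurable_val_shift_pair assms(1)])
  assume "f \<in> space \<nu>"
  then have "(\<lambda>h. (h, f)) -` X = {h \<in> carrier H. val_shift h f \<in> A}"
    by (auto simp: X_def space_pair_measure)
  then show "emeasure (count_space (carrier H)) ((\<lambda>h. (h, f)) -` X) = hits A f"
    by (simp add: hits_def)
qed

lemma emeasure_\<mu>:
  assumes A: "A \<in> sets (map_space G H)"
  shows "emeasure \<mu> A = (\<integral>\<^sup>+ f. hits A f \<partial>\<nu>)"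
proof -
  interpret pair_sigma_finite "count_space (carrier H)" \<nu> by (rule pair_sigma_finite_\<nu>)
  show ?thesis
    unfolding \<mu>_def emeasure_distr[OF measurable_val_shift_pair A]
    using hits_section[OF A] by (subst emeasure_pair_measure_alt2) (auto intro!: nn_integral_cong)
qed

lemma measurable_hits:
  assumes A: "A \<in> sets (map_space G H)"
  shows "hits A \<in> borel_measurable \<nu>"
proof -
  interpret pair_sigma_finite "count_space (carrier H)" \<nu> by (rule pair_sigma_finite_\<nu>)
  have "(\<lambda>f. emeasure (count_space (carrier H)) ((\<lambda>h. (h, f)) -`
      ((\<lambda>(h, f). val_shift h f) -` A \<inter> space (count_space (carrier H) \<Otimes>\<^sub>M \<nu>)))) \<in> borel_measurable \<nu>"
    by (rule measurable_emeasure_Pair2[OF hits_section(1)[OF A]])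
  then show ?thesis
    using hits_section(2)[OF A] by (simp cong: measurable_cong)
qed

lemma hits_left_translate:
  assumes h: "h \<in> carrier H" and f: "f \<in> carrier G \<rightarrow>\<^sub>E carrier H"
  shows "emeasure (count_space (carrier H)) {h' \<in> carrier H. val_shift (h \<otimes>\<^bsub>H\<^esub> h') f \<in> A} = hits A f"
proof -
  have "bij_betw (\<lambda>h'. h \<otimes>\<^bsub>H\<^esub> h') {h' \<in> carrier H. val_shift (h \<otimes>\<^bsub>H\<^esub> h') f \<in> A} {h \<in> carrier H. val_shift h f \<in> A}"
    using h by (intro bij_betwI[where g = "\<lambda>h'. inv\<^bsub>H\<^esub> h \<otimes>\<^bsub>H\<^esub> h'"])
      (auto simp: H.m_assoc[symmetric])
  then show ?thesis unfolding hits_def by (rule emeasure_count_space_bij_betw) auto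
qed

lemma hits_right_translate:
  assumes h: "h \<in> carrier H" and f: "f \<in> carrier G \<rightarrow>\<^sub>E carrier H"
  shows "hits A (val_shift h f) = hits A f"
proof -
  have "{h' \<in> carrier H. val_shift h' (val_shift h f) \<in> A} = {h' \<in> carrier H. val_shift (h' \<otimes>\<^bsub>H\<^esub> h) f \<in> A}"
    using h f by (auto simp: val_shift_mult)
  moreover have "bij_betw (\<lambda>h'. h' \<otimes>\<^bsub>H\<^esub> h) {h' \<in> carrier H. val_shift (h' \<otimes>\<^bsub>H\<^esub> h) f \<in> A} {h \<in> carrier H. val_shift h f \<in> A}"
    using h by (intro bij_betwI[where g = "\<lambda>h'. h' \<otimes>\<^bsub>H\<^esub> inv\<^bsub>H\<^esub> h"]) (auto simp: H.m_assoc)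
  ultimately show ?thesis unfolding hits_def
    using emeasure_count_space_bij_betw by (metis (no_types, lifting) mem_Collect_eq subsetI)
qed

lemma arg_shift_eq_val_shift_increments:
  assumes g: "g \<in> carrier G" and f: "f \<in> carrier G \<rightarrow>\<^sub>E carrier H"
  shows "arg_shift g f = val_shift (f (inv\<^bsub>G\<^esub> g)) (increments G H (inv\<^bsub>G\<^esub> g) f)"
proof -
  have "f k' \<in> carrier H" if "k' \<in> carrier G" for k' using maps_closed[OF f that] .
  then show ?thesis
    using g by (auto simp: arg_shift_def val_shift_def increments_def fun_eq_iff H.m_assoc[symmetric])
qed

lemma distr_\<mu>_val_shift:
  assumes h: "h \<in> carrier H"
  shows "distr \<mu> (map_space G H) (val_shift h) = \<mu>"
proof (rule measure_eqI)
  have m: "val_shift h \<in> \<mu> \<rightarrow>\<^sub>M map_space G H"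
    using measurable_val_shift[OF h] by (simp add: measurable_cong_sets[OF sets_\<mu> refl])
  fix A assume "A \<in> sets (distr \<mu> (map_space G H) (val_shift h))"
  then have A: "A \<in> sets (map_space G H)" by simp
  have B: "val_shift h -` A \<inter> space \<mu> \<in> sets (map_space G H)"
    using measurable_sets[OF m A] by (simp add: sets_\<mu>)
  have "emeasure (distr \<mu> (map_space G H) (val_shift h)) A = emeasure \<mu> (val_shift h -` A \<inter> space \<mu>)"
    by (rule emeasure_distr[OF m A])
  also have "\<dots> = (\<integral>\<^sup>+ f. hits (val_shift h -` A \<inter> space \<mu>) f \<partial>\<nu>)" by (rule emeasure_\<mu>[OF B])
  also have "\<dots> = (\<integral>\<^sup>+ f. hits A f \<partial>\<nu>)"
  proof (rule nn_integral_cong)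
    fix f assume "f \<in> space \<nu>"
    then have f: "f \<in> carrier G \<rightarrow>\<^sub>E carrier H" by (simp add: space_\<nu>)
    have "{h' \<in> carrier H. val_shift h' f \<in> val_shift h -` A \<inter> space \<mu>}
        = {h' \<in> carrier H. val_shift (h \<otimes>\<^bsub>H\<^esub> h') f \<in> A}"
      using h f by (intro Collect_cong conj_cong) (simp_all add: val_shift_mult space_\<mu> val_shift_closed)
    then show "hits (val_shift h -` A \<inter> space \<mu>) f = hits A f"
      unfolding hits_def[of "val_shift h -` A \<inter> space \<mu>"] using hits_left_translate[OF h f] by simp
  qed
  also have "\<dots> = emeasure \<mu> A" by (rule emeasure_\<mu>[OF A, symmetric])
  finally show "emeasure (distr \<mu> (map_space G H) (val_shift h)) A = emeasure \<mu> A" .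
qed (simp add: sets_\<mu>)

text \<open>Up to the \<open>H\<close>-action, which does not change the count of hits, translation by \<open>g\<close> takes
  increments at \<open>inv g\<close>; and these have the law \<open>\<nu>\<close> again.\<close>
lemma distr_\<mu>_arg_shift:
  assumes g: "g \<in> carrier G"
  shows "distr \<mu> (map_space G H) (arg_shift g) = \<mu>"
proof (rule measure_eqI)
  have m: "arg_shift g \<in> \<mu> \<rightarrow>\<^sub>M map_space G H"
    using measurable_arg_shift[OF g] by (simp add: measurable_cong_sets[OF sets_\<mu> refl])
  let ?D = "increments G H (inv\<^bsub>G\<^esub> g)"
  have mD: "?D \<in> \<nu> \<rightarrow>\<^sub>M map_space G H"
    using measurable_increments[OF G.is_group H.is_group countable_H, of "inv\<^bsub>G\<^esub> g"] g
    by (simp add: measurable_cong_sets[OF sets_\<nu> refl])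
  fix A assume "A \<in> sets (distr \<mu> (map_space G H) (arg_shift g))"
  then have A: "A \<in> sets (map_space G H)" by simp
  have B: "arg_shift g -` A \<inter> space \<mu> \<in> sets (map_space G H)"
    using measurable_sets[OF m A] by (simp add: sets_\<mu>)
  have "emeasure (distr \<mu> (map_space G H) (arg_shift g)) A = emeasure \<mu> (arg_shift g -` A \<inter> space \<mu>)"
    by (rule emeasure_distr[OF m A])
  also have "\<dots> = (\<integral>\<^sup>+ f. hits (arg_shift g -` A \<inter> space \<mu>) f \<partial>\<nu>)" by (rule emeasure_\<mu>[OF B])
  also have "\<dots> = (\<integral>\<^sup>+ f. hits A (?D f) \<partial>\<nu>)"
  proof (rule nn_integral_cong)
    fix f assume f': "f \<in> space \<nu>"
    then have f: "f \<in> carrier G \<rightarrow>\<^sub>E carrier H" by (simp add: space_\<nu>)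
    have D: "?D f \<in> carrier G \<rightarrow>\<^sub>E carrier H"
      using measurable_space[OF mD f'] by (simp add: space_map_space)
    have "{h' \<in> carrier H. val_shift h' f \<in> arg_shift g -` A \<inter> space \<mu>} = {h' \<in> carrier H. val_shift h' (arg_shift g f) \<in> A}"
      using f g by (intro Collect_cong conj_cong) (simp_all add: arg_shift_val_shift space_\<mu> val_shift_closed)
    then have "hits (arg_shift g -` A \<inter> space \<mu>) f = hits A (arg_shift g f)" by (simp add: hits_def)
    also have "\<dots> = hits A (?D f)"
      unfolding arg_shift_eq_val_shift_increments[OF g f]
      using g by (intro hits_right_translate D maps_closed[OF f]) simp
    finally show "hits (arg_shift g -` A \<inter> space \<mu>) f = hits A (?D f)" .
  qed
  also have "\<dots> = (\<integral>\<^sup>+ f. hits A f \<partial>(distr \<nu> (map_space G H) ?D))"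
    using measurable_hits[OF A]
    by (intro nn_integral_distr[symmetric, OF mD]) (simp add: measurable_cong_sets[OF sets_\<nu> refl])
  also have "\<dots> = (\<integral>\<^sup>+ f. hits A f \<partial>\<nu>)" using stationary[of "inv\<^bsub>G\<^esub> g"] g by simp
  also have "\<dots> = emeasure \<mu> A" by (rule emeasure_\<mu>[OF A, symmetric])
  finally show "emeasure (distr \<mu> (map_space G H) (arg_shift g)) A = emeasure \<mu> A" .
qed (simp add: sets_\<mu>)

lemma \<Omega>_maps: "f \<in> \<Omega> \<Longrightarrow> f \<in> carrier G \<rightarrow>\<^sub>E carrier H"
  by (simp add: \<Omega>_def)

lemma \<Omega>_inj: "f \<in> \<Omega> \<Longrightarrow> k \<in> carrier G \<Longrightarrow> k' \<in> carrier G \<Longrightarrow> f k = f k' \<longleftrightarrow> k = k'"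
  by (auto simp: \<Omega>_def dest: inj_onD)

lemma \<Omega>_closed: "f \<in> \<Omega> \<Longrightarrow> k \<in> carrier G \<Longrightarrow> f k \<in> carrier H"
  by (simp add: \<Omega>_maps maps_closed)

lemma arg_shift_\<Omega>:
  assumes "g \<in> carrier G" "f \<in> \<Omega>"
  shows "arg_shift g f \<in> \<Omega>"
proof -
  have "inj_on (arg_shift g f) (carrier G)"
  proof (rule inj_onI)
    fix k k' assume k: "k \<in> carrier G" "k' \<in> carrier G" and "arg_shift g f k = arg_shift g f k'"
    then have "inv\<^bsub>G\<^esub> g \<otimes>\<^bsub>G\<^esub> k = inv\<^bsub>G\<^esub> g \<otimes>\<^bsub>G\<^esub> k'"
      using assms by (simp add: arg_shift_def \<Omega>_inj)
    then show "k = k'" using assms(1) k by simp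
  qed
  then show ?thesis using assms arg_shift_closed by (simp add: \<Omega>_def)
qed

lemma val_shift_\<Omega>:
  assumes "h \<in> carrier H" "f \<in> \<Omega>"
  shows "val_shift h f \<in> \<Omega>"
proof -
  have "inj_on (val_shift h f) (carrier G)"
    using assms by (auto simp: inj_on_def val_shift_def \<Omega>_inj \<Omega>_closed)
  then show ?thesis using assms val_shift_closed by (simp add: \<Omega>_def)
qed

lemma sets_of_restrict:
  assumes "finite J" "J \<subseteq> carrier G"
  shows "{f \<in> carrier G \<rightarrow>\<^sub>E carrier H. restrict f J \<in> A} \<in> sets \<mu>"
  using measurable_restrict_vimage[OF assms countable_H, of A] by (simp add: sets_\<mu> space_map_space)

lemma \<Omega>_sets: "\<Omega> \<in> sets \<mu>"
proof -
  have "closedin (discrete_power (carrier G) (carrier H)) \<Omega>"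
    unfolding \<Omega>_def by (rule closedin_inj_maps)
  then have "(carrier G \<rightarrow>\<^sub>E carrier H) - \<Omega> \<in> sets \<mu>"
    unfolding sets_\<mu> sets_PiM_count_space_eq_borel[OF countable_G countable_H]
    by (intro sigma_sets.Basic) (simp add: closedin_def)
  then have "(carrier G \<rightarrow>\<^sub>E carrier H) - ((carrier G \<rightarrow>\<^sub>E carrier H) - \<Omega>) \<in> sets \<mu>"
    using sets.compl_sets[of _ \<mu>] by (simp add: space_\<mu>)
  then show ?thesis using \<Omega>_maps by (simp add: double_diff subset_iff)
qed

lemma space_coupling: "space coupling = \<Omega>"
  using \<Omega>_maps by (auto simp: coupling_def space_restrict_space space_\<mu>)

lemma sets_coupling: "A \<in> sets coupling \<longleftrightarrow> A \<subseteq> \<Omega> \<and> A \<in> sets \<mu>"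
  unfolding coupling_def using \<Omega>_sets
  by (subst sets_restrict_space_iff) (auto simp: sets.Int_space_eq2)

lemma emeasure_coupling: "A \<in> sets coupling \<Longrightarrow> emeasure coupling A = emeasure \<mu> A"
  unfolding coupling_def using \<Omega>_sets sets_coupling[of A, unfolded coupling_def]
  by (intro emeasure_restrict_space) (auto simp: sets.Int_space_eq2)

lemma fiber_sets: "{f \<in> \<Omega>. f \<one>\<^bsub>G\<^esub> = h} \<in> sets coupling"
proof -
  have "{f \<in> \<Omega>. f \<one>\<^bsub>G\<^esub> = h} = \<Omega> \<inter> {f \<in> carrier G \<rightarrow>\<^sub>E carrier H. restrict f {\<one>\<^bsub>G\<^esub>} \<in> {f. f \<one>\<^bsub>G\<^esub> = h}}"
    using \<Omega>_maps by auto
  also have "\<dots> \<in> sets \<mu>" by (intro sets.Int \<Omega>_sets sets_of_restrict) auto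
  finally show ?thesis by (auto simp: sets_coupling)
qed

text \<open>In the \<open>H\<close>-orbit of an injective map exactly one map has the value \<open>h\<close> at \<open>1\<close>.\<close>
lemma emeasure_fiber:
  assumes h: "h \<in> carrier H"
  shows "emeasure coupling {f \<in> \<Omega>. f \<one>\<^bsub>G\<^esub> = h} = 1"
proof -
  interpret prob_space \<nu> by (rule prob_\<nu>)
  have "emeasure coupling {f \<in> \<Omega>. f \<one>\<^bsub>G\<^esub> = h} = (\<integral>\<^sup>+ f. hits {f \<in> \<Omega>. f \<one>\<^bsub>G\<^esub> = h} f \<partial>\<nu>)"
    using fiber_sets sets_coupling sets_\<mu> by (simp add: emeasure_coupling emeasure_\<mu>)
  also have "\<dots> = (\<integral>\<^sup>+ f. 1 \<partial>\<nu>)"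
  proof (rule nn_integral_cong_AE)
    show "AE f in \<nu>. hits {f \<in> \<Omega>. f \<one>\<^bsub>G\<^esub> = h} f = 1"
      using injective
    proof (rule AE_mp, intro AE_I2 impI)
      fix f assume "f \<in> space \<nu>" "inj_on f (carrier G)"
      then have f: "f \<in> \<Omega>" by (simp add: \<Omega>_def space_\<nu>)
      then have f1: "f \<one>\<^bsub>G\<^esub> \<in> carrier H" by (simp add: \<Omega>_closed)
      have "{h' \<in> carrier H. val_shift h' f \<in> {f \<in> \<Omega>. f \<one>\<^bsub>G\<^esub> = h}}
          = {h' \<in> carrier H. h' \<otimes>\<^bsub>H\<^esub> f \<one>\<^bsub>G\<^esub> = h}"
        using val_shift_\<Omega>[OF _ f] by (intro Collect_cong conj_cong) (simp_all add: val_shift_def)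
      also have "\<dots> = {h \<otimes>\<^bsub>H\<^esub> inv\<^bsub>H\<^esub> (f \<one>\<^bsub>G\<^esub>)}"
        using f1 h by (auto simp: H.m_assoc)
      finally have "{h' \<in> carrier H. val_shift h' f \<in> {f \<in> \<Omega>. f \<one>\<^bsub>G\<^esub> = h}}
          = {h \<otimes>\<^bsub>H\<^esub> inv\<^bsub>H\<^esub> (f \<one>\<^bsub>G\<^esub>)}" .
      then show "hits {f \<in> \<Omega>. f \<one>\<^bsub>G\<^esub> = h} f = 1"
        using h f1 by (simp add: hits_def emeasure_count_space)
    qed
  qed
  also have "\<dots> = 1" by (simp add: emeasure_space_1)
  finally show ?thesis .
qed

abbreviation actG :: "'g \<Rightarrow> ('g \<Rightarrow> 'h) \<Rightarrow> 'g \<Rightarrow> 'h" where "actG g \<equiv> restrict (arg_shift g) \<Omega>"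
abbreviation actH :: "'h \<Rightarrow> ('g \<Rightarrow> 'h) \<Rightarrow> 'g \<Rightarrow> 'h" where "actH h \<equiv> restrict (val_shift h) \<Omega>"

text \<open>Only maps in \<open>\<Omega>\<close> are sent into \<open>\<Omega>\<close>, so preimages of subsets of \<open>\<Omega>\<close> may be taken among all maps.\<close>
lemma restrict_measure_preserving:
  assumes t: "t \<in> map_space G H \<rightarrow>\<^sub>M map_space G H" "distr \<mu> (map_space G H) t = \<mu>"
    and closed: "\<And>f. f \<in> \<Omega> \<Longrightarrow> t f \<in> \<Omega>"
    and inverse: "\<And>f. f \<in> carrier G \<rightarrow>\<^sub>E carrier H \<Longrightarrow> t f \<in> \<Omega> \<Longrightarrow> f \<in> \<Omega>"
  shows "restrict t \<Omega> \<in> coupling \<rightarrow>\<^sub>M coupling \<and> distr coupling coupling (restrict t \<Omega>) = coupling"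
proof
  have m: "t \<in> \<mu> \<rightarrow>\<^sub>M map_space G H"
    using t(1) by (simp add: measurable_cong_sets[OF sets_\<mu> refl])
  have vimage: "restrict t \<Omega> -` A \<inter> space coupling = t -` A \<inter> space \<mu>" if "A \<subseteq> \<Omega>" for A
    using that inverse \<Omega>_maps by (auto simp: space_coupling space_\<mu>)
  have A': "t -` A \<inter> space \<mu> \<in> sets coupling" if A: "A \<in> sets coupling" for A
  proof -
    have "t -` A \<inter> space \<mu> \<in> sets \<mu>"
      using A by (intro measurable_sets[OF m]) (simp add: sets_coupling sets_\<mu>)
    moreover have "t -` A \<inter> space \<mu> \<subseteq> \<Omega>"
      using A inverse by (auto simp: sets_coupling space_\<mu>)
    ultimately show ?thesis by (simp add: sets_coupling)
  qed
  show m': "restrict t \<Omega> \<in> coupling \<rightarrow>\<^sub>M coupling"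
  proof (rule measurableI)
    show "restrict t \<Omega> f \<in> space coupling" if "f \<in> space coupling" for f
      using that closed by (simp add: space_coupling)
    show "restrict t \<Omega> -` A \<inter> space coupling \<in> sets coupling" if "A \<in> sets coupling" for A
      using that vimage[of A] A' by (simp add: sets_coupling)
  qed
  show "distr coupling coupling (restrict t \<Omega>) = coupling"
  proof (rule measure_eqI)
    fix A assume "A \<in> sets (distr coupling coupling (restrict t \<Omega>))"
    then have A: "A \<in> sets coupling" by simp
    then have A\<mu>: "A \<subseteq> \<Omega>" "A \<in> sets \<mu>" by (simp_all add: sets_coupling)
    have "emeasure (distr coupling coupling (restrict t \<Omega>)) A = emeasure \<mu> (t -` A \<inter> space \<mu>)"
      using A A' vimage[OF A\<mu>(1)] by (simp add: emeasure_distr[OF m' A] emeasure_coupling)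
    also have "\<dots> = emeasure (distr \<mu> (map_space G H) t) A"
      using A\<mu> by (intro emeasure_distr[symmetric, OF m]) (simp add: sets_\<mu>)
    also have "\<dots> = emeasure coupling A" by (simp add: t(2) emeasure_coupling[OF A])
    finally show "emeasure (distr coupling coupling (restrict t \<Omega>)) A = emeasure coupling A" .
  qed simp
qed

lemma measure_preserving_actG: "measure_preserving_action G coupling actG"
  unfolding measure_preserving_action_def space_coupling
proof (intro conjI ballI)
  show "group_action G \<Omega> actG"
    using arg_shift_\<Omega> by (intro group_actionI) (auto simp: G.is_group arg_shift_one \<Omega>_maps arg_shift_mult)
  fix g assume g: "g \<in> carrier G"
  have "f \<in> \<Omega>" if "f \<in> carrier G \<rightarrow>\<^sub>E carrier H" "arg_shift g f \<in> \<Omega>" for f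
    using arg_shift_\<Omega>[of "inv\<^bsub>G\<^esub> g" "arg_shift g f"] that g arg_shift_mult[of "inv\<^bsub>G\<^esub> g" g f] by (simp add: arg_shift_one)
  then have "actG g \<in> coupling \<rightarrow>\<^sub>M coupling \<and> distr coupling coupling (actG g) = coupling"
    by (intro restrict_measure_preserving measurable_arg_shift distr_\<mu>_arg_shift arg_shift_\<Omega> g)
  then show "actG g \<in> coupling \<rightarrow>\<^sub>M coupling" "distr coupling coupling (actG g) = coupling" by auto
qed

lemma measure_preserving_actH: "measure_preserving_action H coupling actH"
  unfolding measure_preserving_action_def space_coupling
proof (intro conjI ballI)
  show "group_action H \<Omega> actH"
    using val_shift_\<Omega> by (intro group_actionI) (auto simp: H.is_group val_shift_one \<Omega>_maps val_shift_mult)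
  fix h assume h: "h \<in> carrier H"
  have "f \<in> \<Omega>" if "f \<in> carrier G \<rightarrow>\<^sub>E carrier H" "val_shift h f \<in> \<Omega>" for f
    using val_shift_\<Omega>[of "inv\<^bsub>H\<^esub> h" "val_shift h f"] that h val_shift_mult[of "inv\<^bsub>H\<^esub> h" h f] by (simp add: val_shift_one)
  then have "actH h \<in> coupling \<rightarrow>\<^sub>M coupling \<and> distr coupling coupling (actH h) = coupling"
    by (intro restrict_measure_preserving measurable_val_shift distr_\<mu>_val_shift val_shift_\<Omega> h)
  then show "actH h \<in> coupling \<rightarrow>\<^sub>M coupling" "distr coupling coupling (actH h) = coupling" by auto
qed

lemma free_actG: "free_action G \<Omega> actG"
proof -
  have "g = \<one>\<^bsub>G\<^esub>" if "f \<in> \<Omega>" "g \<in> carrier G" "arg_shift g f = f" for f g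
  proof -
    have "f (inv\<^bsub>G\<^esub> g) = arg_shift g f \<one>\<^bsub>G\<^esub>" using that(2) by (simp add: arg_shift_def)
    then have "f (inv\<^bsub>G\<^esub> g) = f \<one>\<^bsub>G\<^esub>" by (simp only: that(3))
    then have "inv\<^bsub>G\<^esub> g = \<one>\<^bsub>G\<^esub>" using that by (simp add: \<Omega>_inj)
    then show ?thesis using that(2) by (metis G.inv_inv G.inv_one)
  qed
  then show ?thesis by (auto simp: free_action_def stabilizer_def arg_shift_one \<Omega>_maps)
qed

lemma free_actH: "free_action H \<Omega> actH"
proof -
  have "h = \<one>\<^bsub>H\<^esub>" if "f \<in> \<Omega>" "h \<in> carrier H" "val_shift h f = f" for f h
  proof -
    have "h \<otimes>\<^bsub>H\<^esub> f \<one>\<^bsub>G\<^esub> = val_shift h f \<one>\<^bsub>G\<^esub>" by (simp add: val_shift_def)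
    then have "h \<otimes>\<^bsub>H\<^esub> f \<one>\<^bsub>G\<^esub> = f \<one>\<^bsub>G\<^esub>" by (simp only: that(3))
    then show ?thesis using that by (simp add: \<Omega>_closed)
  qed
  then show ?thesis by (auto simp: free_action_def stabilizer_def val_shift_one \<Omega>_maps)
qed

lemma to_nat_on_H_eq_iff:
  "h \<in> carrier H \<Longrightarrow> h' \<in> carrier H \<Longrightarrow> to_nat_on (carrier H) h = to_nat_on (carrier H) h' \<longleftrightarrow> h = h'"
  using inj_on_to_nat_on[OF countable_H] by (auto dest: inj_onD)

text \<open>The translates of an injective map \<open>f\<close> attain its values in turn at \<open>1\<close>, so exactly one of them
  attains there the value of least code.\<close>
lemma fundamental_domain_G: "fundamental_domain G coupling actG X\<^sub>G"
  unfolding fundamental_domain_def space_coupling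
proof (intro conjI ballI impI)
  let ?c = "to_nat_on (carrier H)"
  have "X\<^sub>G = \<Omega> \<inter> (\<Inter>k\<in>carrier G. {f \<in> carrier G \<rightarrow>\<^sub>E carrier H. restrict f {\<one>\<^bsub>G\<^esub>, k} \<in> {f. ?c (f \<one>\<^bsub>G\<^esub>) \<le> ?c (f k)}})"
    unfolding X\<^sub>G_def using \<Omega>_maps by auto
  also have "\<dots> \<in> sets \<mu>"
    using countable_G G.one_closed
    by (intro sets.Int \<Omega>_sets sets.countable_INT' image_subsetI sets_of_restrict) auto
  finally show "X\<^sub>G \<in> sets coupling" by (auto simp: sets_coupling X\<^sub>G_def)
next
  fix g assume g: "g \<in> carrier G" "g \<noteq> \<one>\<^bsub>G\<^esub>"
  have False if f: "f \<in> X\<^sub>G" "actG g f \<in> X\<^sub>G" for f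
  proof -
    have f\<Omega>: "f \<in> \<Omega>" using f by (simp add: X\<^sub>G_def)
    have "to_nat_on (carrier H) (f \<one>\<^bsub>G\<^esub>) \<le> to_nat_on (carrier H) (f (inv\<^bsub>G\<^esub> g))"
      using f(1) g by (simp add: X\<^sub>G_def)
    moreover have "to_nat_on (carrier H) (arg_shift g f \<one>\<^bsub>G\<^esub>) \<le> to_nat_on (carrier H) (arg_shift g f g)"
      using f(2) f\<Omega> g by (simp add: X\<^sub>G_def)
    then have "to_nat_on (carrier H) (f (inv\<^bsub>G\<^esub> g)) \<le> to_nat_on (carrier H) (f \<one>\<^bsub>G\<^esub>)"
      using g by (simp add: arg_shift_def)
    ultimately have "inv\<^bsub>G\<^esub> g = \<one>\<^bsub>G\<^esub>"
      using f\<Omega> g by (simp add: to_nat_on_H_eq_iff \<Omega>_closed \<Omega>_inj flip: order.eq_iff)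
    then show False using g by (metis G.inv_inv G.inv_one)
  qed
  then have "actG g ` X\<^sub>G \<inter> X\<^sub>G = {}" by blast
  then show "emeasure coupling (actG g ` X\<^sub>G \<inter> X\<^sub>G) = 0" by simp
next
  have "f \<in> (\<Union>g\<in>carrier G. actG g ` X\<^sub>G)" if f: "f \<in> \<Omega>" for f
  proof -
    obtain k where k: "k \<in> carrier G"
      "\<And>k'. k' \<in> carrier G \<Longrightarrow> to_nat_on (carrier H) (f k) \<le> to_nat_on (carrier H) (f k')"
      using ex_has_least_nat[of "\<lambda>k. k \<in> carrier G" "\<one>\<^bsub>G\<^esub>" "\<lambda>k. to_nat_on (carrier H) (f k)"]
        G.one_closed by blast
    have \<Omega>': "arg_shift (inv\<^bsub>G\<^esub> k) f \<in> \<Omega>" using k(1) f by (simp add: arg_shift_\<Omega>)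
    then have "arg_shift (inv\<^bsub>G\<^esub> k) f \<in> X\<^sub>G" using k by (simp add: X\<^sub>G_def arg_shift_def)
    moreover have "actG k (arg_shift (inv\<^bsub>G\<^esub> k) f) = f"
      using k(1) f \<Omega>' arg_shift_mult[of k "inv\<^bsub>G\<^esub> k" f] by (simp add: arg_shift_one \<Omega>_maps)
    ultimately show ?thesis using k(1) by (metis UN_I imageI)
  qed
  then have "\<Omega> - (\<Union>g\<in>carrier G. actG g ` X\<^sub>G) = {}" by blast
  then show "emeasure coupling (\<Omega> - (\<Union>g\<in>carrier G. actG g ` X\<^sub>G)) = 0"
    by (metis emeasure_empty)
qed

lemma fundamental_domain_H: "fundamental_domain H coupling actH X\<^sub>H"
  unfolding fundamental_domain_def space_coupling
proof (intro conjI ballI impI)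
  show "X\<^sub>H \<in> sets coupling" unfolding X\<^sub>H_def by (rule fiber_sets)
next
  fix h assume h: "h \<in> carrier H" "h \<noteq> \<one>\<^bsub>H\<^esub>"
  have "actH h ` X\<^sub>H \<inter> X\<^sub>H = {}" using h by (auto simp: X\<^sub>H_def val_shift_def)
  then show "emeasure coupling (actH h ` X\<^sub>H \<inter> X\<^sub>H) = 0" by simp
next
  have "f \<in> (\<Union>h\<in>carrier H. actH h ` X\<^sub>H)" if f: "f \<in> \<Omega>" for f
  proof -
    have f1: "f \<one>\<^bsub>G\<^esub> \<in> carrier H" using f by (simp add: \<Omega>_closed)
    let ?f' = "val_shift (inv\<^bsub>H\<^esub> (f \<one>\<^bsub>G\<^esub>)) f"
    have \<Omega>': "?f' \<in> \<Omega>" using f1 f by (simp add: val_shift_\<Omega>)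
    then have "?f' \<in> X\<^sub>H" using f1 by (simp add: X\<^sub>H_def val_shift_def)
    moreover have "actH (f \<one>\<^bsub>G\<^esub>) ?f' = f"
      using f f1 \<Omega>' val_shift_mult[of "f \<one>\<^bsub>G\<^esub>" "inv\<^bsub>H\<^esub> (f \<one>\<^bsub>G\<^esub>)" f] by (simp add: val_shift_one \<Omega>_maps)
    ultimately show ?thesis using f1 by (metis UN_I imageI)
  qed
  then have "\<Omega> - (\<Union>h\<in>carrier H. actH h ` X\<^sub>H) = {}" by blast
  then show "emeasure coupling (\<Omega> - (\<Union>h\<in>carrier H. actH h ` X\<^sub>H)) = 0"
    by (metis emeasure_empty)
qed

lemma sigma_finite_coupling: "sigma_finite_measure coupling"
proof
  let ?F = "(\<lambda>h. {f \<in> \<Omega>. f \<one>\<^bsub>G\<^esub> = h}) ` carrier H"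
  show "\<exists>A. countable A \<and> A \<subseteq> sets coupling \<and> \<Union>A = space coupling \<and>
      (\<forall>a\<in>A. emeasure coupling a \<noteq> \<infinity>)"
  proof (intro exI[of _ ?F] conjI)
    show "countable ?F" using countable_H by simp
    show "?F \<subseteq> sets coupling" using fiber_sets by blast
    show "\<Union>?F = space coupling" using \<Omega>_closed by (auto simp: space_coupling)
    show "\<forall>a\<in>?F. emeasure coupling a \<noteq> \<infinity>" by (auto simp: emeasure_fiber)
  qed
qed

theorem measure_subgroup_coupling:
  "measure_subgroup_coupling G H coupling actG actH X\<^sub>G X\<^sub>H"
  unfolding measure_subgroup_coupling_def space_coupling
proof (intro conjI ballI)
  show "standard_borel coupling"
    unfolding coupling_def \<Omega>_def
    by (rule standard_borel_closed_in_power[OF countable_G countable_H closedin_inj_maps sets_\<mu>])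
  show "emeasure coupling X\<^sub>H = 1" unfolding X\<^sub>H_def by (rule emeasure_fiber) simp
  show "actG g (actH h f) = actH h (actG g f)"
    if "g \<in> carrier G" "h \<in> carrier H" "f \<in> \<Omega>" for g h f
    using that by (simp add: arg_shift_\<Omega> val_shift_\<Omega> arg_shift_val_shift)
qed (fact sigma_finite_coupling measure_preserving_actG measure_preserving_actH free_actG free_actH
    fundamental_domain_G fundamental_domain_H)+

text \<open>The cocycle brings \<open>g * f\<close>, which takes the value \<open>f (inv g)\<close> at \<open>1\<close>, back to the value \<open>1\<close> there; so
  it is the inverse of that value.\<close>
theorem injective_coupling: "injective_coupling G H coupling actG actH X\<^sub>H"
  unfolding injective_coupling_def
proof (intro AE_I2 impI inj_onI)
  fix f g k assume f: "f \<in> space coupling" and g: "g \<in> carrier G" and k: "k \<in> carrier G"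
    and eq: "coupling_cocycle H actG actH X\<^sub>H g f = coupling_cocycle H actG actH X\<^sub>H k f"
  have f\<Omega>: "f \<in> \<Omega>" using f by (simp add: space_coupling)
  have cocycle: "coupling_cocycle H actG actH X\<^sub>H g f = inv\<^bsub>H\<^esub> (f (inv\<^bsub>G\<^esub> g))" if g: "g \<in> carrier G" for g
  proof -
    have c: "f (inv\<^bsub>G\<^esub> g) \<in> carrier H" using f\<Omega> g by (simp add: \<Omega>_closed)
    have "h \<in> carrier H \<and> actH h (actG g f) \<in> X\<^sub>H \<longleftrightarrow> h = inv\<^bsub>H\<^esub> (f (inv\<^bsub>G\<^esub> g))" for h
    proof -
      have "h \<in> carrier H \<and> actH h (actG g f) \<in> X\<^sub>H \<longleftrightarrow> h \<in> carrier H \<and> h \<otimes>\<^bsub>H\<^esub> f (inv\<^bsub>G\<^esub> g) = \<one>\<^bsub>H\<^esub>"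
        using f\<Omega> g arg_shift_\<Omega>[OF g f\<Omega>] val_shift_\<Omega>[OF _ arg_shift_\<Omega>[OF g f\<Omega>]] 
        by (auto simp: X\<^sub>H_def) (auto simp: arg_shift_def val_shift_def)
      also have "\<dots> \<longleftrightarrow> h = inv\<^bsub>H\<^esub> (f (inv\<^bsub>G\<^esub> g))"
        using c H.inv_equality by (auto simp: H.inv_equality)
      finally show ?thesis .
    qed
    then show ?thesis unfolding coupling_cocycle_def by simp
  qed
  have "f (inv\<^bsub>G\<^esub> g) = f (inv\<^bsub>G\<^esub> k)"
    using eq g k f\<Omega> by (simp add: cocycle) (metis G.inv_closed H.inv_inv \<Omega>_closed)
  then have "inv\<^bsub>G\<^esub> g = inv\<^bsub>G\<^esub> k" using f\<Omega> g k by (simp add: \<Omega>_inj)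
  then show "g = k" using g k by (metis G.inv_inv)
qed

end

section \<open>Relabeling the points of a coupling\<close>

locale relabeling =
  fixes M :: "'w measure" and t :: "'w \<Rightarrow> 'z"
  assumes inj_t: "inj_on t (space M)"
begin

abbreviation M' :: "'z measure" where "M' \<equiv> embed_measure M t"

abbreviation t_inv :: "'z \<Rightarrow> 'w" where "t_inv \<equiv> the_inv_into (space M) t"

definition relabel :: "('g \<Rightarrow> 'w \<Rightarrow> 'w) \<Rightarrow> 'g \<Rightarrow> 'z \<Rightarrow> 'z" where
  "relabel \<phi> g = restrict (\<lambda>y. t (\<phi> g (t_inv y))) (t ` space M)"

lemma t_inv_t [simp]: "x \<in> space M \<Longrightarrow> t_inv (t x) = x"
  by (rule the_inv_into_f_f[OF inj_t])

lemma relabel_apply [simp]: "x \<in> space M \<Longrightarrow> relabel \<phi> g (t x) = t (\<phi> g x)"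
  by (simp add: relabel_def)

lemma t_eq_iff: "x \<in> space M \<Longrightarrow> y \<in> space M \<Longrightarrow> t x = t y \<longleftrightarrow> x = y"
  using inj_t by (auto dest: inj_onD)

lemma t_image_iff: "x \<in> space M \<Longrightarrow> A \<subseteq> space M \<Longrightarrow> t x \<in> t ` A \<longleftrightarrow> x \<in> A"
  using inj_t by (auto dest: inj_onD)

lemma sets_M': "sets M' = {t ` A | A. A \<in> sets M}"
  by (rule sets_embed_measure'[OF inj_t])

lemma emeasure_M': "A \<in> sets M \<Longrightarrow> emeasure M' (t ` A) = emeasure M A"
  by (rule emeasure_embed_measure_image'[OF inj_t])

lemma standard_borel_relabel:
  assumes "standard_borel M"
  shows "standard_borel M'"
proof -
  obtain T where T: "completely_metrizable_space T" "second_countable T" "topspace T = space M"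
      "sets M = sigma_sets (space M) {A. openin T A}"
    using assms by (auto simp: standard_borel_def)
  let ?T = "pullback_topology (t ` space M) t_inv T"
  have top: "topspace ?T = t ` space M"
    by (auto simp: topspace_pullback_topology T(3))
  have "continuous_map T ?T t"
  proof (rule continuous_map_pullback')
    show "continuous_map T T (t_inv \<circ> t)"
      by (rule continuous_map_eq[OF continuous_map_id]) (simp add: T(3))
  qed (auto simp: T(3))
  moreover have "continuous_map ?T T t_inv"
    using continuous_map_pullback[OF continuous_map_id, of "t ` space M" t_inv T] by (simp add: o_def)
  ultimately have "homeomorphic_maps T ?T t t_inv"
    by (auto simp: homeomorphic_maps_def top T(3))
  then have "T homeomorphic_space ?T" by (auto simp: homeomorphic_space_def)
  then have "completely_metrizable_space ?T" "second_countable ?T"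
    using T(1,2) homeomorphic_completely_metrizable_space homeomorphic_space_second_countability
    by blast+
  moreover have "sets M' = sigma_sets (space M') {A. openin ?T A}"
  proof -
    have "t ` A = t_inv -` A \<inter> t ` space M" if "A \<subseteq> space M" for A
      using the_inv_into_vimage[OF inj_t that] by simp
    then have "sets M' = {t_inv -` A \<inter> t ` space M | A. A \<in> sets M}"
      unfolding sets_M' using sets.sets_into_space by (metis (no_types, lifting))
    also have "\<dots> = sigma_sets (t ` space M) {t_inv -` A \<inter> t ` space M | A. A \<in> {A. openin T A}}"
      unfolding T(4) by (rule sigma_sets_vimage_commute) auto
    also have "{t_inv -` A \<inter> t ` space M | A. A \<in> {A. openin T A}} = {A. openin ?T A}"
      by (auto simp: openin_pullback_topology)
    finally show ?thesis by (simp add: space_embed_measure)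
  qed
  ultimately show ?thesis
    unfolding standard_borel_def using top by (auto simp: space_embed_measure)
qed

lemma sigma_finite_relabel:
  assumes "sigma_finite_measure M"
  shows "sigma_finite_measure M'"
proof
  obtain \<A> where \<A>: "countable \<A>" "\<A> \<subseteq> sets M" "\<Union>\<A> = space M" "\<forall>a\<in>\<A>. emeasure M a \<noteq> \<infinity>"
    using assms by (auto simp: sigma_finite_measure_def)
  show "\<exists>A. countable A \<and> A \<subseteq> sets M' \<and> \<Union>A = space M' \<and> (\<forall>a\<in>A. emeasure M' a \<noteq> \<infinity>)"
  proof (intro exI[of _ "(`) t ` \<A>"] conjI)
    show "countable ((`) t ` \<A>)" using \<A>(1) by simp
    show "(`) t ` \<A> \<subseteq> sets M'" using \<A>(2) by (auto simp: sets_M')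
    show "\<Union>((`) t ` \<A>) = space M'" using \<A>(3) by (auto simp: space_embed_measure)
    show "\<forall>a\<in>(`) t ` \<A>. emeasure M' a \<noteq> \<infinity>"
    proof clarify
      fix a assume "a \<in> \<A>" "emeasure M' (t ` a) = \<infinity>"
      moreover from this have "emeasure M' (t ` a) = emeasure M a"
        using \<A>(2) by (intro emeasure_M') blast
      ultimately show False using \<A>(4) by simp
    qed
  qed
qed

context
  fixes G :: "('g, 'm) monoid_scheme" and \<phi>
  assumes G: "group G" and act: "measure_preserving_action G M \<phi>"
begin

lemma action: "group_action G (space M) \<phi>"
  using act by (simp add: measure_preserving_action_def)

lemma action_closed: "g \<in> carrier G \<Longrightarrow> x \<in> space M \<Longrightarrow> \<phi> g x \<in> space M"
  using group_action.element_image[OF action] by blast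

lemma relabel_vimage:
  assumes "g \<in> carrier G" "A \<subseteq> space M"
  shows "relabel \<phi> g -` (t ` A) \<inter> space M' = t ` (\<phi> g -` A \<inter> space M)"
proof -
  have "relabel \<phi> g (t x) \<in> t ` A \<longleftrightarrow> \<phi> g x \<in> A" if "x \<in> space M" for x
    using that assms by (simp add: t_image_iff action_closed)
  then show ?thesis unfolding space_embed_measure by blast
qed

lemma measure_preserving_relabel: "measure_preserving_action G M' (relabel \<phi>)"
  unfolding measure_preserving_action_def
proof (intro conjI ballI)
  show "group_action G (space M') (relabel \<phi>)"
    unfolding relabel_def space_embed_measure
  proof (rule group_actionI[OF G])
    show "t (\<phi> \<one>\<^bsub>G\<^esub> (t_inv y)) = y" if "y \<in> t ` space M" for y
      using that group_action.id_eq_one[OF action] by (auto simp: fun_eq_iff restrict_def split: if_splits)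
  qed (auto simp: action_closed group_action.composition_rule[OF action])
  fix g assume g: "g \<in> carrier G"
  have m: "\<phi> g \<in> M \<rightarrow>\<^sub>M M" and d: "distr M M (\<phi> g) = M"
    using act g by (auto simp: measure_preserving_action_def)
  show m': "relabel \<phi> g \<in> M' \<rightarrow>\<^sub>M M'"
  proof (rule measurableI)
    show "relabel \<phi> g y \<in> space M'" if "y \<in> space M'" for y
      using that g by (auto simp: space_embed_measure action_closed)
    show "relabel \<phi> g -` B \<inter> space M' \<in> sets M'" if B: "B \<in> sets M'" for B
    proof -
      obtain A where A: "B = t ` A" "A \<in> sets M" using B by (auto simp: sets_M')
      show ?thesis
        using relabel_vimage[OF g sets.sets_into_space[OF A(2)]] measurable_sets[OF m A(2)]
        by (auto simp: A(1) sets_M')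
    qed
  qed
  show "distr M' M' (relabel \<phi> g) = M'"
  proof (rule measure_eqI)
    fix B assume "B \<in> sets (distr M' M' (relabel \<phi> g))"
    then have B: "B \<in> sets M'" by simp
    then obtain A where A: "B = t ` A" "A \<in> sets M" by (auto simp: sets_M')
    have "emeasure (distr M' M' (relabel \<phi> g)) B = emeasure M' (t ` (\<phi> g -` A \<inter> space M))"
      using relabel_vimage[OF g sets.sets_into_space[OF A(2)]] emeasure_distr[OF m' B]
      unfolding A(1) by (simp only:)
    also have "\<dots> = emeasure (distr M M (\<phi> g)) A"
      by (simp add: emeasure_M'[OF measurable_sets[OF m A(2)]] emeasure_distr[OF m A(2)])
    also have "\<dots> = emeasure M' B" by (simp add: d A emeasure_M')
    finally show "emeasure (distr M' M' (relabel \<phi> g)) B = emeasure M' B" .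
  qed simp
qed

lemma free_relabel:
  assumes "free_action G (space M) \<phi>"
  shows "free_action G (space M') (relabel \<phi>)"
  using assms
  by (auto simp: free_action_def stabilizer_def space_embed_measure t_eq_iff action_closed cong: conj_cong)

lemma relabel_image: "A \<subseteq> space M \<Longrightarrow> relabel \<phi> g ` (t ` A) = t ` (\<phi> g ` A)"
  by (auto simp: image_iff subset_iff)

lemma action_image_sets:
  assumes g: "g \<in> carrier G" and A: "A \<in> sets M"
  shows "\<phi> g ` A \<in> sets M"
proof -
  interpret group G by (rule G)
  interpret group_action G "space M" \<phi> by (rule action)
  have "\<phi> g ` A = \<phi> (inv\<^bsub>G\<^esub> g) -` A \<inter> space M"
  proof (intro equalityI subsetI)
    fix y assume "y \<in> \<phi> g ` A"
    then show "y \<in> \<phi> (inv\<^bsub>G\<^esub> g) -` A \<inter> space M"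
      using g sets.sets_into_space[OF A] orbit_sym_aux[OF g] action_closed by auto
  next
    fix y assume y: "y \<in> \<phi> (inv\<^bsub>G\<^esub> g) -` A \<inter> space M"
    then have "\<phi> g (\<phi> (inv\<^bsub>G\<^esub> g) y) = y"
      using orbit_sym_aux[of "inv\<^bsub>G\<^esub> g" y] g by simp
    then show "y \<in> \<phi> g ` A" using y by force
  qed
  moreover have "\<phi> (inv\<^bsub>G\<^esub> g) \<in> M \<rightarrow>\<^sub>M M"
    using act g by (simp add: measure_preserving_action_def)
  ultimately show ?thesis using measurable_sets[OF _ A] by metis
qed

text \<open>Countability of \<open>G\<close> makes the union of the translates measurable, so that its complement can be
  carried over.\<close>
lemma fundamental_domain_relabel:
  assumes "countable (carrier G)" and fd: "fundamental_domain G M \<phi> X"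
  shows "fundamental_domain G M' (relabel \<phi>) (t ` X)"
  unfolding fundamental_domain_def
proof (intro conjI ballI impI)
  have X: "X \<in> sets M" using fd by (simp add: fundamental_domain_def)
  then have X': "X \<subseteq> space M" by (rule sets.sets_into_space)
  show "t ` X \<in> sets M'" using X by (auto simp: sets_M')
  have im: "\<phi> g ` X \<subseteq> space M" if "g \<in> carrier G" for g
    using X' action_closed[OF that] by auto
  show "emeasure M' (relabel \<phi> g ` (t ` X) \<inter> t ` X) = 0" if g: "g \<in> carrier G" "g \<noteq> \<one>\<^bsub>G\<^esub>" for g
  proof -
    have "relabel \<phi> g ` (t ` X) \<inter> t ` X = t ` (\<phi> g ` X \<inter> X)"
      unfolding relabel_image[OF X'] using inj_on_image_Int[OF inj_t im[OF g(1)] X'] by simp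
    then show ?thesis
      using fd g X by (simp add: fundamental_domain_def emeasure_M' action_image_sets sets.Int)
  qed
  have "(\<Union>g\<in>carrier G. \<phi> g ` X) \<in> sets M"
    using action_image_sets X assms(1) by (intro sets.countable_UN') auto
  moreover have "space M' - (\<Union>g\<in>carrier G. relabel \<phi> g ` (t ` X)) = t ` (space M - (\<Union>g\<in>carrier G. \<phi> g ` X))"
    unfolding relabel_image[OF X'] space_embed_measure
    using inj_on_image_set_diff[OF inj_t, of "space M" "\<Union>g\<in>carrier G. \<phi> g ` X"] im
    by (simp add: image_UN UN_subset_iff)
  ultimately show "emeasure M' (space M' - (\<Union>g\<in>carrier G. relabel \<phi> g ` (t ` X))) = 0"
    using fd by (simp add: fundamental_domain_def emeasure_M')
qed

end

lemma coupling_relabel: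
  assumes G: "group G" "countable (carrier G)" and H: "group H" "countable (carrier H)"
    and coupling: "measure_subgroup_coupling G H M \<phi> \<psi> X Y"
    and injective: "injective_coupling G H M \<phi> \<psi> Y"
  shows "measure_subgroup_coupling G H M' (relabel \<phi>) (relabel \<psi>) (t ` X) (t ` Y)"
    and "injective_coupling G H M' (relabel \<phi>) (relabel \<psi>) (t ` Y)"
proof -
  have c: "standard_borel M" "sigma_finite_measure M"
    "measure_preserving_action G M \<phi>" "measure_preserving_action H M \<psi>"
    "free_action G (space M) \<phi>" "free_action H (space M) \<psi>"
    "\<And>g h x. g \<in> carrier G \<Longrightarrow> h \<in> carrier H \<Longrightarrow> x \<in> space M \<Longrightarrow> \<phi> g (\<psi> h x) = \<psi> h (\<phi> g x)"
    "fundamental_domain G M \<phi> X" "fundamental_domain H M \<psi> Y" "emeasure M Y = 1"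
    using coupling by (auto simp: measure_subgroup_coupling_def)
  note closedG = action_closed[OF G(1) c(3)] and closedH = action_closed[OF H(1) c(4)]
  have Y: "Y \<in> sets M" using c(9) by (simp add: fundamental_domain_def)
  then have Y': "Y \<subseteq> space M" by (rule sets.sets_into_space)
  show "measure_subgroup_coupling G H M' (relabel \<phi>) (relabel \<psi>) (t ` X) (t ` Y)"
    unfolding measure_subgroup_coupling_def
    using standard_borel_relabel[OF c(1)] sigma_finite_relabel[OF c(2)]
      measure_preserving_relabel[OF G(1) c(3)] measure_preserving_relabel[OF H(1) c(4)]
      free_relabel[OF G(1) c(3,5)] free_relabel[OF H(1) c(4,6)]
      fundamental_domain_relabel[OF G(1) c(3) G(2) c(8)] fundamental_domain_relabel[OF H(1) c(4) H(2) c(9)]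
    by (auto simp: space_embed_measure closedG closedH c(7) c(10) emeasure_M'[OF Y])
  have "coupling_cocycle H (relabel \<phi>) (relabel \<psi>) (t ` Y) g (t x) = coupling_cocycle H \<phi> \<psi> Y g x"
    if g: "g \<in> carrier G" and x: "x \<in> space M" for g x
    unfolding coupling_cocycle_def
    by (rule arg_cong[where f = The], rule ext, rule conj_cong)
      (simp_all add: g x closedG closedH t_image_iff[OF _ Y'])
  then have "inj_on (\<lambda>g. coupling_cocycle H (relabel \<phi>) (relabel \<psi>) (t ` Y) g (t x)) (carrier G)
      \<longleftrightarrow> inj_on (\<lambda>g. coupling_cocycle H \<phi> \<psi> Y g x) (carrier G)" if "x \<in> space M" for x
    using that by (intro inj_on_cong) auto
  then show "injective_coupling G H M' (relabel \<phi>) (relabel \<psi>) (t ` Y)"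
    using injective unfolding injective_coupling_def AE_embed_measure'[OF inj_t]
    by (auto simp: t_image_iff[OF _ Y'] elim!: AE_mp intro!: AE_I2)
qed

end

text \<open>A map between countable sets is coded by its graph, a set of pairs of naturals, and sets of
  naturals embed into the reals.\<close>
lemma ex_inj_countable_power_real:
  assumes I: "countable I" and B: "countable B"
  shows "\<exists>t :: ('i \<Rightarrow> 'b) \<Rightarrow> real. inj_on t (I \<rightarrow>\<^sub>E B)"
proof -
  obtain e :: "nat set \<Rightarrow> real" where e: "inj e"
    using nat_sets_lepoll_reals01 by (auto simp: lepoll_def)
  define graph where "graph f = (\<lambda>i. prod_encode (to_nat_on I i, to_nat_on B (f i))) ` I" for f :: "'i \<Rightarrow> 'b"
  have "inj_on graph (I \<rightarrow>\<^sub>E B)"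
  proof (rule inj_onI)
    fix f f' assume f: "f \<in> I \<rightarrow>\<^sub>E B" "f' \<in> I \<rightarrow>\<^sub>E B" and eq: "graph f = graph f'"
    have "f i = f' i" if i: "i \<in> I" for i
    proof -
      have "prod_encode (to_nat_on I i, to_nat_on B (f i)) \<in> graph f'"
        using eq i by (auto simp: graph_def)
      then obtain j where j: "j \<in> I" "to_nat_on I i = to_nat_on I j" "to_nat_on B (f i) = to_nat_on B (f' j)"
        by (auto simp: graph_def prod_encode_eq)
      then have "i = j" using i inj_on_to_nat_on[OF I] by (auto dest: inj_onD)
      then show ?thesis
        using j inj_onD[OF inj_on_to_nat_on[OF B], of "f i" "f' i"] PiE_mem[OF f(1) i] PiE_mem[OF f(2) i]
        by simp
    qed
    then show "f = f'" using f by (auto intro: PiE_ext)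
  qed
  then have "inj_on (e \<circ> graph) (I \<rightarrow>\<^sub>E B)"
    using e by (intro comp_inj_on) (auto intro: inj_on_subset)
  then show ?thesis by blast
qed

theorem theorem1p6:
  fixes G :: "('g, 'm) monoid_scheme" and H :: "('h, 'k) monoid_scheme"
    and S\<^sub>G :: "'g set" and S\<^sub>H :: "'h set"
    and \<G> :: "nat \<Rightarrow> ('v, 'g) lgraph"
    and U :: "nat filter"
    and u :: "nat \<Rightarrow> 'v \<Rightarrow> 'h"
  assumes "group G" and "finite S\<^sub>G" and "S\<^sub>G \<subseteq> carrier G" and "generate G S\<^sub>G = carrier G"
    and "group H" and "finite S\<^sub>H" and "S\<^sub>H \<subseteq> carrier H" and "generate H S\<^sub>H = carrier H"
    and "sofic_approximation G S\<^sub>G \<G>"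
    and "nonprincipal_ultrafilter U"
    and "\<And>n. u n ` verts (\<G> n) \<subseteq> carrier H" and "\<And>n. inj_on (u n) (verts (\<G> n))"
    and "statistically_lipschitz U \<G> H S\<^sub>H u"
  shows "\<exists>(M :: real measure) \<phi> \<psi> X\<^sub>G X\<^sub>H.
    measure_subgroup_coupling G H M \<phi> \<psi> X\<^sub>G X\<^sub>H \<and> injective_coupling G H M \<phi> \<psi> X\<^sub>H"
proof -
  interpret A: lipschitz_injections G S\<^sub>G H S\<^sub>H \<G> U u
    using assms
    by (intro lipschitz_injections.intro generated_group.intro generated_group_axioms.intro
        lipschitz_injections_axioms.intro)
  have countable: "countable (carrier G)" "countable (carrier H)"
    using A.G.countable_carrier assms(2-4) A.H.countable_carrier assms(6-8) by blast+
  obtain \<nu> where \<nu>: "prob_space \<nu> \<and> sets \<nu> = sets (map_space G H) \<and>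
    (AE f in \<nu>. inj_on f (carrier G)) \<and>
    (\<forall>g \<in> carrier G. distr \<nu> (map_space G H) (increments G H g) = \<nu>)"
    using A.ex_stationary_law by (rule exE)
  interpret B: stationary_injection G H \<nu>
    using assms(1,5) countable \<nu>
    by (intro stationary_injection.intro stationary_injection_axioms.intro) auto
  obtain t :: "('g \<Rightarrow> 'h) \<Rightarrow> real" where t: "inj_on t (carrier G \<rightarrow>\<^sub>E carrier H)"
    using ex_inj_countable_power_real[OF countable] by blast
  interpret C: relabeling B.coupling t
    by standard (rule inj_on_subset[OF t], use B.\<Omega>_maps B.space_coupling in blast)
  show ?thesis
    using C.coupling_relabel[OF assms(1) countable(1) assms(5) countable(2)
        B.measure_subgroup_coupling B.injective_coupling] by blast
qed

end
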